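(* The timed problems DA-Reconf-TS and OA-Reconf-TS, parameterized by $k+\ell$ (where $k=|A_s|=|A_t|$ is the size of the given alliances and $\ell$ is the upper bound on the length of the reconfiguration sequence), are fixed-parameter tractable.
   Context: Graphs are finite, simple, undirected. For $A\subseteq V$: $\partial A=N(A)\setminus A$, $d_A(v)=|N(v)\cap A|$. $A$ is a defensive alliance (DA) if $d_A(v)+1\ge d_{V\setminus A}(v)$ for all $v\in A$; an offensive alliance (OA) if $d_A(v)\ge d_{V\setminus A}(v)+1$ for all $v\in\partial A$. $B$ is obtained from $A$ by a token sliding step if $|A|=|B|$, $|A\setminus B|=1$, and the vertex in $A\setminus B$ is adjacent to the vertex in $B\setminus A$. Timed $X$-Reconf-TS ($X\in\{\text{DA},\text{OA}\}$): given $G$, two sets $A_s,A_t$ with property $X$ and a bound $\ell$, decide whether there is a sequence $A_s=A_1,\dots,A_m=A_t$ with $m\le\ell$ of sets with property $X$, each $A_{i+1}$ obtained from $A_i$ by a token sliding step. *)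

theory Defs
  imports "Graph_Theory.Pair_Digraph"
begin

section \<open>Alliances and token sliding\<close>

text \<open>
  A finite simple undirected graph is a \<open>pair_graph\<close>: finitely many vertices and a symmetric,
  loop-free arc relation \<open>parcs G\<close>, an edge being represented by both of its orientations.
\<close>

definition nbrs :: "'a pair_pre_digraph \<Rightarrow> 'a \<Rightarrow> 'a set" where
  "nbrs G v = {u \<in> pverts G. (v, u) \<in> parcs G}"

definition boundary :: "'a pair_pre_digraph \<Rightarrow> 'a set \<Rightarrow> 'a set" where
  "boundary G A = (\<Union>v\<in>A. nbrs G v) - A"

definition deg_in :: "'a pair_pre_digraph \<Rightarrow> 'a set \<Rightarrow> 'a \<Rightarrow> nat" where
  "deg_in G A v = card (nbrs G v \<inter> A)"

definition defensive_alliance :: "'a pair_pre_digraph \<Rightarrow> 'a set \<Rightarrow> bool" where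
  "defensive_alliance G A \<longleftrightarrow>
     A \<subseteq> pverts G \<and> (\<forall>v\<in>A. deg_in G A v + 1 \<ge> deg_in G (pverts G - A) v)"

definition offensive_alliance :: "'a pair_pre_digraph \<Rightarrow> 'a set \<Rightarrow> bool" where
  "offensive_alliance G A \<longleftrightarrow>
     A \<subseteq> pverts G \<and> (\<forall>v\<in>boundary G A. deg_in G A v \<ge> deg_in G (pverts G - A) v + 1)"

definition sliding_step :: "'a pair_pre_digraph \<Rightarrow> 'a set \<Rightarrow> 'a set \<Rightarrow> bool" where
  "sliding_step G A B \<longleftrightarrow>
     card A = card B \<and> (\<exists>u v. A - B = {u} \<and> B - A = {v} \<and> (u, v) \<in> parcs G)"

text \<open>The bound \<open>l\<close> counts the sets in the sequence, not the steps.\<close>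

definition reconfigurable_within ::
    "('a pair_pre_digraph \<Rightarrow> 'a set \<Rightarrow> bool) \<Rightarrow> 'a pair_pre_digraph \<Rightarrow> 'a set \<Rightarrow> 'a set \<Rightarrow> nat \<Rightarrow> bool"
  where
  "reconfigurable_within X G S T l \<longleftrightarrow>
     (\<exists>As. As \<noteq> [] \<and> hd As = S \<and> last As = T \<and> length As \<le> l \<and>
           (\<forall>A\<in>set As. X G A) \<and> successively (sliding_step G) As)"


section \<open>Random access machines\<close>

text \<open>
  Uniform-cost random access machines in structured form. A state consists of registers,
  which a program addresses directly (so it uses only finitely many of them), and an unbounded
  memory, which it addresses through registers. The only arithmetic operations are constants,
  addition and truncated subtraction, so numbers grow by at most one bit per step beyond the
  lengths of the input numbers and of the program's constants; hence step counts are polynomially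
  related to Turing machine time.
\<close>

type_synonym state = "(nat \<Rightarrow> nat) \<times> (nat \<Rightarrow> nat)"

datatype com =
    Skip
  | Const nat nat
  | Add nat nat nat
  | Sub nat nat nat
  | Load nat nat
  | Store nat nat
  | Seq com com
  | IfNZ nat com com
  | WhileNZ nat com

inductive exec :: "com \<Rightarrow> state \<Rightarrow> nat \<Rightarrow> state \<Rightarrow> bool" where
  Skip: "exec Skip s 1 s"
| Const: "exec (Const r n) (R, M) 1 (R(r := n), M)"
| Add: "exec (Add r a b) (R, M) 1 (R(r := R a + R b), M)"
| Sub: "exec (Sub r a b) (R, M) 1 (R(r := R a - R b), M)"
| Load: "exec (Load r a) (R, M) 1 (R(r := M (R a)), M)"
| Store: "exec (Store a r) (R, M) 1 (R, M(R a := R r))"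
| Seq: "exec c s t s' \<Longrightarrow> exec d s' t' s'' \<Longrightarrow> exec (Seq c d) s (t + t') s''"
| IfTrue: "fst s r \<noteq> 0 \<Longrightarrow> exec c s t s' \<Longrightarrow> exec (IfNZ r c d) s (t + 1) s'"
| IfFalse: "fst s r = 0 \<Longrightarrow> exec d s t s' \<Longrightarrow> exec (IfNZ r c d) s (t + 1) s'"
| WhileTrue: "fst s r \<noteq> 0 \<Longrightarrow> exec c s t s' \<Longrightarrow> exec (WhileNZ r c) s' t' s'' \<Longrightarrow>
    exec (WhileNZ r c) s (t + t' + 1) s''"
| WhileFalse: "fst s r = 0 \<Longrightarrow> exec (WhileNZ r c) s 1 s"

inductive_cases exec_SkipE: "exec Skip s t s'"
inductive_cases exec_ConstE: "exec (Const r n) s t s'"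
inductive_cases exec_AddE: "exec (Add r a b) s t s'"
inductive_cases exec_SubE: "exec (Sub r a b) s t s'"
inductive_cases exec_LoadE: "exec (Load r a) s t s'"
inductive_cases exec_StoreE: "exec (Store a r) s t s'"
inductive_cases exec_SeqE: "exec (Seq c d) s t s'"
inductive_cases exec_IfE: "exec (IfNZ r c d) s t s'"
inductive_cases exec_WhileE: "exec (WhileNZ r c) s t s'"

lemma exec_deterministic:
  "exec c s t s' \<Longrightarrow> exec c s u s'' \<Longrightarrow> t = u \<and> s' = s''"
proof (induction arbitrary: u s'' rule: exec.induct)
  case (Skip s)
  then show ?case by (auto elim: exec_SkipE)
next
  case (Const r n R M)
  then show ?case by (auto elim: exec_ConstE)
next
  case (Add r a b R M)
  then show ?case by (auto elim: exec_AddE)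
next
  case (Sub r a b R M)
  then show ?case by (auto elim: exec_SubE)
next
  case (Load r a R M)
  then show ?case by (auto elim: exec_LoadE)
next
  case (Store a r R M)
  then show ?case by (auto elim: exec_StoreE)
next
  case (Seq c s t s' d t' s1)
  from Seq.prems obtain v s2 v' where
      "exec c s v s2" "exec d s2 v' s''" "u = v + v'"
    by (rule exec_SeqE) simp
  then show ?case
    using Seq.IH by blast
next
  case (IfTrue s r c t s' d)
  from IfTrue.prems obtain v where "exec c s v s''" "u = v + 1"
    by (rule exec_IfE) (use IfTrue.hyps in auto)
  then show ?case
    using IfTrue.IH by blast
next
  case (IfFalse s r d t s' c)
  from IfFalse.prems obtain v where "exec d s v s''" "u = v + 1"
    by (rule exec_IfE) (use IfFalse.hyps in auto)
  then show ?case
    using IfFalse.IH by blast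
next
  case (WhileTrue s r c t s' t' s1)
  from WhileTrue.prems obtain v s2 v' where
      "exec c s v s2" "exec (WhileNZ r c) s2 v' s''" "u = v + v' + 1"
    by (rule exec_WhileE) (use WhileTrue.hyps in auto)
  then show ?case
    using WhileTrue.IH by blast
next
  case (WhileFalse s r c)
  from WhileFalse.prems show ?case
    by (rule exec_WhileE) (simp_all add: WhileFalse.hyps)
qed

definition computable :: "(nat \<Rightarrow> nat) \<Rightarrow> bool" where
  "computable f \<longleftrightarrow>
     (\<exists>c. \<forall>n. \<exists>t R M. exec c ((\<lambda>_. 0)(0 := n), \<lambda>_. 0) t (R, M) \<and> R 0 = f n)"


section \<open>Fixed-parameter tractability\<close>

text \<open>
  A parameterized problem is a set of pairs of a binary string and a parameter value. The
  parameter is supplied in register 0, the length of the string in register 1, and the string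
  itself in the memory. The size of the input \<open>(x, p)\<close> is \<open>length x + p\<close>; the additional 1 only
  keeps the bound positive on the empty input.
\<close>

type_synonym parameterized_problem = "(bool list \<times> nat) set"

definition input_state :: "bool list \<Rightarrow> nat \<Rightarrow> state" where
  "input_state x p =
     ((\<lambda>_. 0)(0 := p, 1 := length x), \<lambda>i. if i < length x then of_bool (x ! i) else 0)"

definition fixed_parameter_tractable :: "parameterized_problem \<Rightarrow> bool" where
  "fixed_parameter_tractable L \<longleftrightarrow>
     (\<exists>c f d. computable f \<and>
        (\<forall>x p. \<exists>t R M. exec c (input_state x p) t (R, M) \<and>
           R 0 = of_bool ((x, p) \<in> L) \<and>
           t \<le> f p * (length x + p + 1) ^ d))"


section \<open>The timed reconfiguration problems\<close>

text \<open>Binary representation, least significant bit first, without superfluous zeros.\<close>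

fun nat_bits :: "nat \<Rightarrow> bool list" where
  "nat_bits n = (if n = 0 then [] else odd n # nat_bits (n div 2))"

declare nat_bits.simps [simp del]

text \<open>
  A graph on the vertices \<open>0, \<dots>, n - 1\<close> with two vertex sets and a number is encoded as \<open>n\<close> in
  unary, the two characteristic vectors, the adjacency matrix row by row, and the number in binary.
\<close>

definition encode_instance :: "nat pair_pre_digraph \<Rightarrow> nat set \<Rightarrow> nat set \<Rightarrow> nat \<Rightarrow> bool list" where
  "encode_instance G S T l =
     (let n = card (pverts G) in
      replicate n True @ [False] @
      map (\<lambda>v. v \<in> S) [0..<n] @
      map (\<lambda>v. v \<in> T) [0..<n] @
      concat (map (\<lambda>u. map (\<lambda>v. (u, v) \<in> parcs G) [0..<n]) [0..<n]) @
      nat_bits l)"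

definition timed_reconf_TS ::
    "(nat pair_pre_digraph \<Rightarrow> nat set \<Rightarrow> bool) \<Rightarrow> parameterized_problem" where
  "timed_reconf_TS X =
     {(encode_instance G S T l, k + l) | G S T k l.
        pair_graph G \<and> pverts G = {0..<card (pverts G)} \<and>
        X G S \<and> X G T \<and> card S = k \<and> card T = k \<and>
        reconfigurable_within X G S T l}"

end

theory Submission
  imports Defs "HOL-Library.Nat_Bijection"
begin

text \<open>
  If a token slides from \<open>u\<close> to \<open>v\<close> between two alliances \<open>A\<close> and \<open>B\<close> of size \<open>k\<close>, then
  \<open>u\<close> has degree at most \<open>2 k + 1\<close>: in the defensive case because \<open>u\<close> belongs to \<open>A\<close>, in the
  offensive case because \<open>u\<close> lies in the boundary of \<open>B\<close>. Hence an alliance has at most \<open>3 k\<^sup>2\<close>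
  successors. With \<open>b = 3 p\<^sup>2 + 1\<close>, every number \<open>c < b ^ l\<close> is read as a list of \<open>l\<close> digits that
  prescribe a walk: digit \<open>d\<close> selects the successor of rank \<open>d\<close>, or no move if there is none. It
  remains to test whether one of these walks leads to the target.

  The whole test is a single primitive recursive expression over the input, with vertex sets coded
  as numbers. Such expressions are compiled to the machine once and for all, and their running time
  is polynomial in a common bound of the lengths of all recursions.
\<close>

section \<open>Primitive recursive expressions on the machine\<close>

text \<open>Digits that named the two vertices of a move would give about \<open>n ^ 2\<close>
  choices per step, too many for fixed-parameter tractability. Only the rank among the moves that
  lead to alliances has a range bounded in \<open>k\<close>, and a rank is found in polynomial time
  by counting over pairs of vertices. The constants arise as follows: in one of the two alliances,
  \<open>u\<close> has at most \<open>k\<close> neighbours inside and at most one more outside than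
  inside, and \<open>k * (2 * k + 1) \<le> 3 * (k * k)\<close>. The 1 in \<open>b\<close> is a digit
  reserved for standing still, so that shorter sequences are walks as well. Two obstacles shape the
  rest. The bound \<open>l\<close> is written in binary and may be exponential in the length of the
  string, so the search must be guarded by the test \<open>k + l = p\<close>, and the time bounds
  must follow the branch that is taken. Codes of sets reach \<open>2 ^ n\<close>: adding,
  subtracting and comparing them costs one step, but they must never be the number of rounds of a
  recursion. Moreover, ill-formed strings have to be rejected, which requires a description of the
  encodings cell by cell.\<close>

text \<open>
  In the step \<open>s\<close> of \<open>Rec i r n z s\<close>, register \<open>i\<close> holds the number of the round and \<open>r\<close> the
  value reached so far.
\<close>

datatype expr =
    Var nat
  | Lit nat
  | Plus expr expr
  | Minus expr expr
  | Mem expr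
  | Cond expr expr expr
  | Rec nat nat expr expr expr

fun eval :: "expr \<Rightarrow> (nat \<Rightarrow> nat) \<Rightarrow> (nat \<Rightarrow> nat) \<Rightarrow> nat" where
  "eval (Var x) R M = R x"
| "eval (Lit n) R M = n"
| "eval (Plus a b) R M = eval a R M + eval b R M"
| "eval (Minus a b) R M = eval a R M - eval b R M"
| "eval (Mem a) R M = M (eval a R M)"
| "eval (Cond c a b) R M = (if eval c R M \<noteq> 0 then eval a R M else eval b R M)"
| "eval (Rec i r n z s) R M =
     rec_nat (eval z R M) (\<lambda>j acc. eval s (R(i := j, r := acc)) M) (eval n R M)"

text \<open>These are exact step counts of the compiled code. In \<open>Rec\<close>, the 15 collects
  the setup (8), the last loop test (1) and the final moves (6); the 5 per round is the loop test
  plus the four steps that copy the result and update the counters.\<close>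

fun cost :: "expr \<Rightarrow> (nat \<Rightarrow> nat) \<Rightarrow> (nat \<Rightarrow> nat) \<Rightarrow> nat" where
  "cost (Var x) R M = 2"
| "cost (Lit n) R M = 1"
| "cost (Plus a b) R M = cost a R M + cost b R M + 1"
| "cost (Minus a b) R M = cost a R M + cost b R M + 1"
| "cost (Mem a) R M = cost a R M + 1"
| "cost (Cond c a b) R M =
     cost c R M + (if eval c R M \<noteq> 0 then cost a R M else cost b R M) + 1"
| "cost (Rec i r n z s) R M =
     cost n R M + cost z R M + 15 +
     (\<Sum>j<eval n R M. cost s (R(i := j, r := eval (Rec i r (Lit j) z s) R M)) M + 5)"

text \<open>Separates the registers that an expression names from the scratch registers, which start
  at \<open>k\<close>.\<close>

fun below :: "nat \<Rightarrow> expr \<Rightarrow> bool" where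
  "below k (Var x) \<longleftrightarrow> x < k"
| "below k (Lit n) \<longleftrightarrow> True"
| "below k (Plus a b) \<longleftrightarrow> below k a \<and> below k b"
| "below k (Minus a b) \<longleftrightarrow> below k a \<and> below k b"
| "below k (Mem a) \<longleftrightarrow> below k a"
| "below k (Cond c a b) \<longleftrightarrow> below k c \<and> below k a \<and> below k b"
| "below k (Rec i r n z s) \<longleftrightarrow> i < k \<and> r < k \<and> i \<noteq> r \<and> below k n \<and> below k z \<and> below k s"

definition Move :: "nat \<Rightarrow> nat \<Rightarrow> com" where
  "Move d x = Seq (Const d 0) (Add d x d)"

text \<open>
  The result is left in register \<open>k\<close>, and only registers from \<open>k\<close> on are changed. The loop of
  \<open>Rec\<close> counts down in register \<open>k\<close>; the old contents of \<open>i\<close> and \<open>r\<close> are saved in \<open>k + 2\<close> and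
  \<open>k + 3\<close>.
\<close>

fun compile :: "nat \<Rightarrow> expr \<Rightarrow> com" where
  "compile k (Var x) = Move k x"
| "compile k (Lit n) = Const k n"
| "compile k (Plus a b) = Seq (compile k a) (Seq (compile (k + 1) b) (Add k k (k + 1)))"
| "compile k (Minus a b) = Seq (compile k a) (Seq (compile (k + 1) b) (Sub k k (k + 1)))"
| "compile k (Mem a) = Seq (compile k a) (Load k k)"
| "compile k (Cond c a b) = Seq (compile k c) (IfNZ k (compile k a) (compile k b))"
| "compile k (Rec i r n z s) =
     Seq (compile k n) (Seq (compile (k + 1) z)
     (Seq (Move (k + 2) i) (Seq (Move (k + 3) r)
     (Seq (Move r (k + 1)) (Seq (Const i 0) (Seq (Const (k + 1) 1)
     (Seq (WhileNZ k
        (Seq (compile (k + 4) s) (Seq (Move r (k + 4)) (Seq (Add i i (k + 1)) (Sub k k (k + 1))))))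
     (Seq (Move k r) (Seq (Move i (k + 2)) (Move r (k + 3)))))))))))"

text \<open>Needed whenever an operand is evaluated after an earlier one has overwritten scratch
  registers.\<close>

lemma eval_cong:
  assumes "below k e" "\<And>x. x < k \<Longrightarrow> R x = R' x"
  shows "eval e R M = eval e R' M" "cost e R M = cost e R' M"
proof -
  have "eval e R M = eval e R' M \<and> cost e R M = cost e R' M"
    using assms
  proof (induction e arbitrary: R R')
    case (Rec i r n z s)
    have s: "eval s (R(i := j, r := acc)) M = eval s (R'(i := j, r := acc)) M \<and>
        cost s (R(i := j, r := acc)) M = cost s (R'(i := j, r := acc)) M" for j acc
      using Rec.prems by (intro Rec.IH(3)) auto
    have "eval n R M = eval n R' M \<and> cost n R M = cost n R' M"
      and "eval z R M = eval z R' M \<and> cost z R M = cost z R' M"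
      using Rec.prems by (intro Rec.IH; simp)+
    then show ?case
      by (simp add: s)
  next
    case (Plus a b)
    have "eval a R M = eval a R' M \<and> cost a R M = cost a R' M"
      and "eval b R M = eval b R' M \<and> cost b R M = cost b R' M"
      using Plus.prems by (intro Plus.IH; simp)+
    then show ?case by simp
  next
    case (Minus a b)
    have "eval a R M = eval a R' M \<and> cost a R M = cost a R' M"
      and "eval b R M = eval b R' M \<and> cost b R M = cost b R' M"
      using Minus.prems by (intro Minus.IH; simp)+
    then show ?case by simp
  next
    case (Mem a)
    have "eval a R M = eval a R' M \<and> cost a R M = cost a R' M"
      using Mem.prems by (intro Mem.IH) simp_all
    then show ?case by simp
  next
    case (Cond c a b)
    have "eval c R M = eval c R' M \<and> cost c R M = cost c R' M"
      and "eval a R M = eval a R' M \<and> cost a R M = cost a R' M"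
      and "eval b R M = eval b R' M \<and> cost b R M = cost b R' M"
      using Cond.prems by (intro Cond.IH; simp)+
    then show ?case by simp
  qed auto
  then show "eval e R M = eval e R' M" "cost e R M = cost e R' M"
    by auto
qed

lemma exec_Move:
  "d \<noteq> x \<Longrightarrow> exec (Move d x) (R, M) 2 (R(d := R x), M)"
  unfolding Move_def
  using exec.Seq[OF exec.Const[of d 0 R M] exec.Add[of d x d "R(d := 0)" M]]
  by (simp add: numeral_2_eq_2)

lemma below_mono: "below k e \<Longrightarrow> k \<le> k' \<Longrightarrow> below k' e"
  by (induction e) auto

text \<open>Invariant of the loop of \<open>Rec\<close> after \<open>j\<close> of \<open>j + d\<close> rounds.\<close>

lemma exec_Rec_loop:
  assumes body: "\<And>R. \<exists>R'. exec c (R, M) (cost s R M) (R', M) \<and>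
        (\<forall>x<k + 4. R' x = R x) \<and> R' (k + 4) = eval s R M"
    and s: "below k s" and ir: "i < k" "r < k" "i \<noteq> r"
    and Rk: "R k = d" "R (k + 1) = 1" "R i = j" "R r = eval (Rec i r (Lit j) z s) R0 M"
      "\<And>x. x < k \<Longrightarrow> x \<noteq> i \<Longrightarrow> x \<noteq> r \<Longrightarrow> R x = R0 x"
  shows "\<exists>R'. exec (WhileNZ k (Seq c (Seq (Move r (k + 4)) (Seq (Add i i (k + 1)) (Sub k k (k + 1))))))
      (R, M) ((\<Sum>j\<in>{j..<j + d}. cost s (R0(i := j, r := eval (Rec i r (Lit j) z s) R0 M)) M + 5) + 1) (R', M) \<and>
      R' r = eval (Rec i r (Lit (j + d)) z s) R0 M \<and> R' (k + 2) = R (k + 2) \<and> R' (k + 3) = R (k + 3) \<and>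
      (\<forall>x<k. x \<noteq> i \<longrightarrow> x \<noteq> r \<longrightarrow> R' x = R0 x)"
  using Rk
proof (induction d arbitrary: j R)
  case 0
  then show ?case
    using exec.WhileFalse[of "(R, M)" k] by (auto intro!: exI[of _ R])
next
  case (Suc d)
  \<comment> \<open>\<open>?S\<close> is the state in which the recursor evaluates round
    \<open>j\<close>. The machine agrees with it below \<open>k\<close>, so \<open>eval_cong\<close>
    transfers value and cost of the body.\<close>
  let ?S = "R0(i := j, r := eval (Rec i r (Lit j) z s) R0 M)"
  have S: "R x = ?S x" if "x < k" for x
    using Suc.prems that ir by auto
  have Sev: "eval s R M = eval s ?S M" "cost s R M = cost s ?S M"
    by (rule eval_cong[OF s], erule S)+
  obtain R1 where R1: "exec c (R, M) (cost s R M) (R1, M)" "\<forall>x<k + 4. R1 x = R x"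
      "R1 (k + 4) = eval s R M"
    using body by blast
  define R2 where "R2 = R1(r := R1 (k + 4))"
  define R3 where "R3 = R2(i := R2 i + R2 (k + 1))"
  define R4 where "R4 = R3(k := R3 k - R3 (k + 1))"
  have R4: "exec (Seq c (Seq (Move r (k + 4)) (Seq (Add i i (k + 1)) (Sub k k (k + 1)))))
      (R, M) (cost s R M + (2 + (1 + 1))) (R4, M)"
    unfolding R4_def R3_def R2_def
    by (rule exec.Seq[OF R1(1)], rule exec.Seq[OF exec_Move], use ir in simp,
        rule exec.Seq[OF exec.Add exec.Sub])
  have "\<exists>R'. exec (WhileNZ k (Seq c (Seq (Move r (k + 4)) (Seq (Add i i (k + 1)) (Sub k k (k + 1))))))
      (R4, M) ((\<Sum>j\<in>{Suc j..<Suc j + d}. cost s (R0(i := j, r := eval (Rec i r (Lit j) z s) R0 M)) M + 5) + 1) (R', M) \<and>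
      R' r = eval (Rec i r (Lit (Suc j + d)) z s) R0 M \<and> R' (k + 2) = R4 (k + 2) \<and> R' (k + 3) = R4 (k + 3) \<and>
      (\<forall>x<k. x \<noteq> i \<longrightarrow> x \<noteq> r \<longrightarrow> R' x = R0 x)"
  proof (rule Suc.IH)
    show "R4 k = d" "R4 (k + 1) = 1" "R4 i = Suc j"
      using Suc.prems R1(2) ir by (auto simp: R4_def R3_def R2_def)
    show "R4 x = R0 x" if "x < k" "x \<noteq> i" "x \<noteq> r" for x
      using that Suc.prems R1(2) ir by (auto simp: R4_def R3_def R2_def)
    show "R4 r = eval (Rec i r (Lit (Suc j)) z s) R0 M"
      using ir by (simp add: R4_def R3_def R2_def R1(3) Sev(1))
  qed
  then obtain R' where R': "exec (WhileNZ k (Seq c (Seq (Move r (k + 4)) (Seq (Add i i (k + 1)) (Sub k k (k + 1))))))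
      (R4, M) ((\<Sum>j\<in>{Suc j..<Suc j + d}. cost s (R0(i := j, r := eval (Rec i r (Lit j) z s) R0 M)) M + 5) + 1) (R', M)"
    "R' r = eval (Rec i r (Lit (Suc j + d)) z s) R0 M" "R' (k + 2) = R4 (k + 2)" "R' (k + 3) = R4 (k + 3)"
      "\<forall>x<k. x \<noteq> i \<longrightarrow> x \<noteq> r \<longrightarrow> R' x = R0 x"
    by (elim exE conjE) (rule that)
  have sum: "(\<Sum>j\<in>{j..<j + Suc d}. h j) = h j + (\<Sum>j\<in>{Suc j..<Suc j + d}. h j)" for h :: "nat \<Rightarrow> nat"
    by (subst sum.atLeast_Suc_lessThan) auto
  have "cost s R M + (2 + (1 + 1)) +
        ((\<Sum>j\<in>{Suc j..<Suc j + d}. cost s (R0(i := j, r := eval (Rec i r (Lit j) z s) R0 M)) M + 5) + 1) + 1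
      = (\<Sum>j\<in>{j..<j + Suc d}. cost s (R0(i := j, r := eval (Rec i r (Lit j) z s) R0 M)) M + 5) + 1"
    unfolding sum Sev(2) by linarith
  moreover have "fst (R, M) k \<noteq> 0"
    using Suc.prems by simp
  ultimately have ex: "exec (WhileNZ k (Seq c (Seq (Move r (k + 4)) (Seq (Add i i (k + 1)) (Sub k k (k + 1))))))
      (R, M) ((\<Sum>j\<in>{j..<j + Suc d}. cost s (R0(i := j, r := eval (Rec i r (Lit j) z s) R0 M)) M + 5) + 1) (R', M)"
    using exec.WhileTrue[OF _ R4 R'(1)] by metis
  have "R4 (k + 2) = R (k + 2)" "R4 (k + 3) = R (k + 3)"
    using R1(2) ir by (simp_all add: R4_def R3_def R2_def)
  then have "R' (k + 2) = R (k + 2)" "R' (k + 3) = R (k + 3)"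
    using R'(3,4) by simp_all
  moreover have "R' r = eval (Rec i r (Lit (j + Suc d)) z s) R0 M"
    unfolding R'(2) by simp
  ultimately show ?case
    using R'(5) ex by (intro exI conjI)
qed

text \<open>The induction varies \<open>k\<close>: a second operand is compiled one register higher,
  so that the first result survives, and a loop body four higher, above the counter, the constant 1
  and the two saved registers.\<close>

theorem compile_correct:
  assumes "below k e"
  shows "\<exists>R'. exec (compile k e) (R, M) (cost e R M) (R', M) \<and>
           (\<forall>x<k. R' x = R x) \<and> R' k = eval e R M"
  using assms
proof (induction e arbitrary: k R)
  case (Var x)
  then show ?case
    using exec_Move[of k x R M] by (auto intro!: exI[of _ "R(k := R x)"])
next
  case (Lit n)
  then show ?case
    using exec.Const[of k n R M] by (auto intro!: exI[of _ "R(k := n)"])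
next
  case (Plus a b)
  obtain R1 where R1: "exec (compile k a) (R, M) (cost a R M) (R1, M)"
      "\<forall>x<k. R1 x = R x" "R1 k = eval a R M"
    using Plus.IH(1)[of k R] Plus.prems by auto
  obtain R2 where R2: "exec (compile (k + 1) b) (R1, M) (cost b R1 M) (R2, M)"
      "\<forall>x<k + 1. R2 x = R1 x" "R2 (k + 1) = eval b R1 M"
    using Plus.IH(2)[of "k + 1" R1] Plus.prems below_mono[of k b "k + 1"] by auto
  have b: "eval b R1 M = eval b R M" "cost b R1 M = cost b R M"
    using Plus.prems R1(2) eval_cong[of k b R1 R M] by auto
  define R3 where "R3 = R2(k := R2 k + R2 (k + 1))"
  have "exec (compile k (Plus a b)) (R, M) (cost a R M + (cost b R1 M + 1)) (R3, M)"
    unfolding R3_def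
    unfolding compile.simps by (rule exec.Seq[OF R1(1) exec.Seq[OF R2(1) exec.Add]])
  moreover have "\<forall>x<k. R3 x = R x" "R3 k = eval (Plus a b) R M"
    using R1 R2 b by (auto simp: R3_def)
  ultimately show ?case
    using b by (auto simp: add.assoc)
next
  case (Minus a b)
  obtain R1 where R1: "exec (compile k a) (R, M) (cost a R M) (R1, M)"
      "\<forall>x<k. R1 x = R x" "R1 k = eval a R M"
    using Minus.IH(1)[of k R] Minus.prems by auto
  obtain R2 where R2: "exec (compile (k + 1) b) (R1, M) (cost b R1 M) (R2, M)"
      "\<forall>x<k + 1. R2 x = R1 x" "R2 (k + 1) = eval b R1 M"
    using Minus.IH(2)[of "k + 1" R1] Minus.prems below_mono[of k b "k + 1"] by auto
  have b: "eval b R1 M = eval b R M" "cost b R1 M = cost b R M"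
    using Minus.prems R1(2) eval_cong[of k b R1 R M] by auto
  define R3 where "R3 = R2(k := R2 k - R2 (k + 1))"
  have "exec (compile k (Minus a b)) (R, M) (cost a R M + (cost b R1 M + 1)) (R3, M)"
    unfolding R3_def
    unfolding compile.simps by (rule exec.Seq[OF R1(1) exec.Seq[OF R2(1) exec.Sub]])
  moreover have "\<forall>x<k. R3 x = R x" "R3 k = eval (Minus a b) R M"
    using R1 R2 b by (auto simp: R3_def)
  ultimately show ?case
    using b by (auto simp: add.assoc)
next
  case (Mem a)
  obtain R1 where R1: "exec (compile k a) (R, M) (cost a R M) (R1, M)"
      "\<forall>x<k. R1 x = R x" "R1 k = eval a R M"
    using Mem.IH[of k R] Mem.prems by auto
  define R2 where "R2 = R1(k := M (R1 k))"
  have "exec (compile k (Mem a)) (R, M) (cost a R M + 1) (R2, M)"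
    unfolding R2_def
    unfolding compile.simps by (rule exec.Seq[OF R1(1) exec.Load])
  moreover have "\<forall>x<k. R2 x = R x" "R2 k = eval (Mem a) R M"
    using R1 by (auto simp: R2_def)
  ultimately show ?case
    by auto
next
  case (Cond c a b)
  obtain R1 where R1: "exec (compile k c) (R, M) (cost c R M) (R1, M)"
      "\<forall>x<k. R1 x = R x" "R1 k = eval c R M"
    using Cond.IH(1)[of k R] Cond.prems by auto
  define e where "e = (if eval c R M \<noteq> 0 then a else b)"
  obtain R2 where R2: "exec (compile k e) (R1, M) (cost e R1 M) (R2, M)"
      "\<forall>x<k. R2 x = R1 x" "R2 k = eval e R1 M"
    using Cond.IH(2,3)[of k R1] Cond.prems by (cases "eval c R M = 0") (auto simp: e_def)
  have e: "eval e R1 M = eval e R M" "cost e R1 M = cost e R M"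
    using Cond.prems R1(2) eval_cong[of k e R1 R M] by (auto simp: e_def)
  have "exec (IfNZ k (compile k a) (compile k b)) (R1, M) (cost e R1 M + 1) (R2, M)"
    using R2(1) R1(3) exec.IfTrue[of "(R1, M)" k] exec.IfFalse[of "(R1, M)" k]
    by (cases "eval c R M = 0") (simp_all add: e_def)
  then have "exec (compile k (Cond c a b)) (R, M) (cost c R M + (cost e R1 M + 1)) (R2, M)"
    unfolding compile.simps by (rule exec.Seq[OF R1(1)])
  then show ?case
    using R1(2) R2(2,3) e by (intro exI[of _ R2]) (auto simp: e_def add.assoc)
next
  case (Rec i r n z s)
  then have ir: "i < k" "r < k" "i \<noteq> r" and b: "below k n" "below k z" "below k s"
    by auto
  obtain R1 where R1: "exec (compile k n) (R, M) (cost n R M) (R1, M)"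
      "\<forall>x<k. R1 x = R x" "R1 k = eval n R M"
    using Rec.IH(1)[of k R] b by auto
  obtain R2 where R2: "exec (compile (k + 1) z) (R1, M) (cost z R1 M) (R2, M)"
      "\<forall>x<k + 1. R2 x = R1 x" "R2 (k + 1) = eval z R1 M"
    using Rec.IH(2)[of "k + 1" R1] below_mono[OF b(2), of "k + 1"] by auto
  have z: "eval z R1 M = eval z R M" "cost z R1 M = cost z R M"
    using b R1(2) eval_cong[of k z R1 R M] by auto
  \<comment> \<open>Saving and restoring \<open>i\<close> and \<open>r\<close> gives them the scope
    of bound variables, so nested recursions may share register numbers.\<close>
  define R3 where "R3 = R2(k + 2 := R2 i)"
  define R4 where "R4 = R3(k + 3 := R3 r)"
  define R5 where "R5 = R4(r := R4 (k + 1))"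
  define R6 where "R6 = R5(i := 0)"
  define R7 where "R7 = R6(k + 1 := 1)"
  have R37: "exec (Move (k + 2) i) (R2, M) 2 (R3, M)" "exec (Move (k + 3) r) (R3, M) 2 (R4, M)"
    "exec (Move r (k + 1)) (R4, M) 2 (R5, M)" "exec (Const i 0) (R5, M) 1 (R6, M)"
    "exec (Const (k + 1) 1) (R6, M) 1 (R7, M)"
    unfolding R3_def R4_def R5_def R6_def R7_def 
    by ((rule exec_Move, use ir in simp) | rule exec.Const)+
  have R7: "R7 k = eval n R M" "R7 (k + 1) = 1" "R7 i = 0" "R7 r = eval z R M"
    "R7 (k + 2) = R i" "R7 (k + 3) = R r" "\<And>x. x < k \<Longrightarrow> x \<noteq> i \<Longrightarrow> x \<noteq> r \<Longrightarrow> R7 x = R x"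
    using R1 R2 z ir by (simp_all add: R7_def R6_def R5_def R4_def R3_def)
  have "\<exists>R'. exec (WhileNZ k
        (Seq (compile (k + 4) s) (Seq (Move r (k + 4)) (Seq (Add i i (k + 1)) (Sub k k (k + 1))))))
      (R7, M) ((\<Sum>j\<in>{0..<0 + eval n R M}. cost s (R(i := j, r := eval (Rec i r (Lit j) z s) R M)) M + 5) + 1) (R', M) \<and>
      R' r = eval (Rec i r (Lit (0 + eval n R M)) z s) R M \<and> R' (k + 2) = R7 (k + 2) \<and> R' (k + 3) = R7 (k + 3) \<and>
      (\<forall>x<k. x \<noteq> i \<longrightarrow> x \<noteq> r \<longrightarrow> R' x = R x)"
  proof (rule exec_Rec_loop)
    show "\<exists>R'. exec (compile (k + 4) s) (R, M) (cost s R M) (R', M) \<and>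
        (\<forall>x<k + 4. R' x = R x) \<and> R' (k + 4) = eval s R M" for R
      using below_mono[OF b(3), of "k + 4"] by (intro Rec.IH(3)) auto
    show "R7 r = eval (Rec i r (Lit 0) z s) R M"
      by (simp add: R7(4))
  qed (use ir b R7 in simp_all)
  then obtain R8 where R8: "exec (WhileNZ k
        (Seq (compile (k + 4) s) (Seq (Move r (k + 4)) (Seq (Add i i (k + 1)) (Sub k k (k + 1))))))
      (R7, M) ((\<Sum>j<eval n R M. cost s (R(i := j, r := eval (Rec i r (Lit j) z s) R M)) M + 5) + 1) (R8, M)"
      "R8 r = eval (Rec i r n z s) R M" "R8 (k + 2) = R i" "R8 (k + 3) = R r"
      "\<forall>x<k. x \<noteq> i \<longrightarrow> x \<noteq> r \<longrightarrow> R8 x = R x"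
    unfolding atLeast0LessThan add_0 R7(5,6) by auto
  define R9 where "R9 = R8(k := R8 r)"
  define R10 where "R10 = R9(i := R9 (k + 2))"
  define R11 where "R11 = R10(r := R10 (k + 3))"
  have R911: "exec (Move k r) (R8, M) 2 (R9, M)" "exec (Move i (k + 2)) (R9, M) 2 (R10, M)"
    "exec (Move r (k + 3)) (R10, M) 2 (R11, M)"
    unfolding R9_def R10_def R11_def by (rule exec_Move, use ir in simp)+
  have "exec (compile k (Rec i r n z s)) (R, M)
     (cost n R M + (cost z R1 M + (2 + (2 + (2 + (1 + (1 +
       (((\<Sum>j<eval n R M. cost s (R(i := j, r := eval (Rec i r (Lit j) z s) R M)) M + 5) + 1) +
       (2 + (2 + 2)))))))))) (R11, M)"
    unfolding compile.simps
    by (rule exec.Seq[OF R1(1) exec.Seq[OF R2(1) exec.Seq[OF R37(1) exec.Seq[OF R37(2)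
        exec.Seq[OF R37(3) exec.Seq[OF R37(4) exec.Seq[OF R37(5) exec.Seq[OF R8(1)
        exec.Seq[OF R911(1) exec.Seq[OF R911(2,3)]]]]]]]]]])
  moreover have "cost n R M + (cost z R1 M + (2 + (2 + (2 + (1 + (1 +
       (((\<Sum>j<eval n R M. cost s (R(i := j, r := eval (Rec i r (Lit j) z s) R M)) M + 5) + 1) +
       (2 + (2 + 2))))))))) = cost (Rec i r n z s) R M"
    using z by simp
  ultimately have ex: "exec (compile k (Rec i r n z s)) (R, M) (cost (Rec i r n z s) R M) (R11, M)"
    by (simp only:)
  have "R11 k = eval (Rec i r n z s) R M"
    using R8(2) ir by (simp add: R11_def R10_def R9_def)
  moreover have "R11 x = R x" if "x < k" for x
    using R8(3-5) ir that by (cases "x = r"; cases "x = i") (simp_all add: R11_def R10_def R9_def)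
  ultimately show ?case
    using ex by blast
qed

section \<open>Polynomial running time from bounded recursions\<close>

text \<open>Only the branch of \<open>Cond\<close> that is taken is examined, so a guard can protect
  a recursion that would otherwise be too long. The values computed remain unrestricted.\<close>

fun bounded :: "nat \<Rightarrow> expr \<Rightarrow> (nat \<Rightarrow> nat) \<Rightarrow> (nat \<Rightarrow> nat) \<Rightarrow> bool" where
  "bounded m (Var x) R M \<longleftrightarrow> True"
| "bounded m (Lit n) R M \<longleftrightarrow> True"
| "bounded m (Plus a b) R M \<longleftrightarrow> bounded m a R M \<and> bounded m b R M"
| "bounded m (Minus a b) R M \<longleftrightarrow> bounded m a R M \<and> bounded m b R M"
| "bounded m (Mem a) R M \<longleftrightarrow> bounded m a R M"
| "bounded m (Cond c a b) R M \<longleftrightarrow> bounded m c R M \<and>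
     (if eval c R M \<noteq> 0 then bounded m a R M else bounded m b R M)"
| "bounded m (Rec i r n z s) R M \<longleftrightarrow> bounded m n R M \<and> bounded m z R M \<and> eval n R M \<le> m \<and>
     (\<forall>j<eval n R M. bounded m s (R(i := j, r := eval (Rec i r (Lit j) z s) R M)) M)"

fun depth :: "expr \<Rightarrow> nat" where
  "depth (Var x) = 0"
| "depth (Lit n) = 0"
| "depth (Plus a b) = depth a + depth b"
| "depth (Minus a b) = depth a + depth b"
| "depth (Mem a) = depth a"
| "depth (Cond c a b) = depth c + depth a + depth b"
| "depth (Rec i r n z s) = depth n + depth z + depth s + 1"

fun weight :: "expr \<Rightarrow> nat" where
  "weight (Var x) = 2"
| "weight (Lit n) = 1"
| "weight (Plus a b) = weight a + weight b + 1"
| "weight (Minus a b) = weight a + weight b + 1"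
| "weight (Mem a) = weight a + 1"
| "weight (Cond c a b) = weight c + weight a + weight b + 1"
| "weight (Rec i r n z s) = weight n + weight z + weight s + 20"

text \<open>Each \<open>Rec\<close> multiplies the cost of its body by at most \<open>m\<close>,
  which raises the exponent by 1. The constants 15 and 5 of \<open>cost\<close> add up to the 20 in
  \<open>weight\<close>, and \<open>m \<ge> 1\<close> absorbs all smaller powers.\<close>

lemma cost_le:
  assumes "bounded m e R M" "m \<ge> 1"
  shows "cost e R M \<le> weight e * m ^ depth e"
  using assms(1)
proof (induction e arbitrary: R)
  case (Var x)
  then show ?case by simp
next
  case (Lit n)
  then show ?case by simp
next
  case (Plus a b)
  have "weight a * m ^ depth a \<le> weight a * m ^ (depth a + depth b)"
    "weight b * m ^ depth b \<le> weight b * m ^ (depth a + depth b)"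
    "1 \<le> m ^ (depth a + depth b)"
    using \<open>m \<ge> 1\<close> by (auto intro: power_increasing mult_left_mono)
  moreover have "cost a R M \<le> weight a * m ^ depth a" "cost b R M \<le> weight b * m ^ depth b"
    using Plus by auto
  ultimately show ?case
    unfolding cost.simps weight.simps depth.simps distrib_right by linarith
next
  case (Minus a b)
  have "weight a * m ^ depth a \<le> weight a * m ^ (depth a + depth b)"
    "weight b * m ^ depth b \<le> weight b * m ^ (depth a + depth b)"
    "1 \<le> m ^ (depth a + depth b)"
    using \<open>m \<ge> 1\<close> by (auto intro: power_increasing mult_left_mono)
  moreover have "cost a R M \<le> weight a * m ^ depth a" "cost b R M \<le> weight b * m ^ depth b"
    using Minus by auto
  ultimately show ?case
    unfolding cost.simps weight.simps depth.simps distrib_right by linarith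
next
  case (Mem a)
  have "1 \<le> m ^ depth a"
    using \<open>m \<ge> 1\<close> by simp
  moreover have "cost a R M \<le> weight a * m ^ depth a"
    using Mem by auto
  ultimately show ?case
    unfolding cost.simps weight.simps depth.simps distrib_right by linarith
next
  case (Cond c a b)
  let ?D = "m ^ (depth c + depth a + depth b)"
  have D: "weight c * m ^ depth c \<le> weight c * ?D" "weight a * m ^ depth a \<le> weight a * ?D"
    "weight b * m ^ depth b \<le> weight b * ?D" "1 \<le> ?D"
    using \<open>m \<ge> 1\<close> by (auto intro: power_increasing mult_left_mono)
  have "cost c R M \<le> weight c * m ^ depth c"
    using Cond by auto
  moreover have "cost a R M \<le> weight a * m ^ depth a" if "eval c R M \<noteq> 0"
    using Cond that by auto
  moreover have "cost b R M \<le> weight b * m ^ depth b" if "eval c R M = 0"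
    using Cond that by auto
  ultimately show ?case
    using D unfolding cost.simps weight.simps depth.simps distrib_right
    by (cases "eval c R M = 0"; simp only: if_True if_False not_not simp_thms) linarith+
next
  case (Rec i r n z s)
  let ?D = "m ^ (depth n + depth z + depth s)"
  have D: "weight n * m ^ depth n \<le> weight n * (m * ?D)" "weight z * m ^ depth z \<le> weight z * (m * ?D)"
    "15 \<le> 15 * (m * ?D)"
    using \<open>m \<ge> 1\<close> power_increasing[of _ "Suc (depth n + depth z + depth s)" m]
    by (auto intro!: mult_left_mono)
  have "m ^ depth s \<le> ?D"
    using \<open>m \<ge> 1\<close> by (intro power_increasing) auto
  then have Ds: "weight s * m ^ depth s \<le> weight s * ?D" "1 \<le> ?D"
    using \<open>m \<ge> 1\<close> by auto
  have n: "eval n R M \<le> m"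
    using Rec.prems by simp
  have "(\<Sum>j<eval n R M. cost s (R(i := j, r := eval (Rec i r (Lit j) z s) R M)) M + 5)
      \<le> (\<Sum>j<eval n R M. weight s * m ^ depth s + 5)"
    using Rec.prems unfolding bounded.simps lessThan_iff[symmetric]
    by (intro sum_mono add_right_mono Rec.IH(3)) blast
  also have "\<dots> \<le> m * (weight s * m ^ depth s + 5)"
    using n by simp
  also have "\<dots> \<le> m * (weight s * ?D + 5 * ?D)"
    using Ds(2) by (intro mult_left_mono add_mono Ds(1)) auto
  also have "\<dots> = weight s * (m * ?D) + 5 * (m * ?D)"
    by (simp add: algebra_simps)
  finally have s: "(\<Sum>j<eval n R M. cost s (R(i := j, r := eval (Rec i r (Lit j) z s) R M)) M + 5)
      \<le> weight s * (m * ?D) + 5 * (m * ?D)" .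
  have nz: "cost n R M \<le> weight n * m ^ depth n" "cost z R M \<le> weight z * m ^ depth z"
    using Rec by auto
  have D': "m ^ depth (Rec i r n z s) = m * ?D"
    by simp
  have w: "weight (Rec i r n z s) * (m * ?D) =
      weight n * (m * ?D) + weight z * (m * ?D) + weight s * (m * ?D) + 20 * (m * ?D)"
    by (simp add: algebra_simps)
  show ?case
    unfolding D' w cost.simps using s nz D by linarith
qed

definition program :: "expr \<Rightarrow> com" where
  "program e = Seq (compile 50 e) (Move 0 50)"

lemma exec_program:
  assumes "below 50 e"
  shows "\<exists>R'. exec (program e) (R, M) (cost e R M + 2) (R', M) \<and> R' 0 = eval e R M"
proof -
  obtain R' where R': "exec (compile 50 e) (R, M) (cost e R M) (R', M)" "R' 50 = eval e R M"
    using compile_correct[OF assms, of R M] by (elim exE conjE) (rule that)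
  have "exec (Move 0 50) (R', M) 2 (R'(0 := R' 50), M)"
    by (rule exec_Move) simp
  from exec.Seq[OF R'(1) this]
  have "exec (program e) (R, M) (cost e R M + 2) (R'(0 := R' 50), M)"
    unfolding program_def .
  moreover have "(R'(0 := R' 50)) 0 = eval e R M"
    using R'(2) by simp
  ultimately show ?thesis
    by (intro exI conjI)
qed

lemma computable_expr:
  assumes "below 50 e"
  shows "computable (\<lambda>n. eval e ((\<lambda>_. 0)(0 := n)) (\<lambda>_. 0))"
  unfolding computable_def
proof (rule exI, rule allI)
  fix n
  obtain R' where "exec (program e) ((\<lambda>_. 0)(0 := n), \<lambda>_. 0) (cost e ((\<lambda>_. 0)(0 := n)) (\<lambda>_. 0) + 2) (R', \<lambda>_. 0)"
      "R' 0 = eval e ((\<lambda>_. 0)(0 := n)) (\<lambda>_. 0)"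
    using exec_program[OF assms, of "(\<lambda>_. 0)(0 := n)" "\<lambda>_. 0"] by (elim exE conjE) (rule that)
  then show "\<exists>t R M. exec (program e) ((\<lambda>_. 0)(0 := n), \<lambda>_. 0) t (R, M) \<and>
      R 0 = eval e ((\<lambda>_. 0)(0 := n)) (\<lambda>_. 0)"
    by (intro exI conjI)
qed

section \<open>The decision procedure as an expression\<close>

definition notE :: "expr \<Rightarrow> expr" where
  "notE e = Cond e (Lit 0) (Lit 1)"

definition andE :: "expr \<Rightarrow> expr \<Rightarrow> expr" where
  "andE a b = Cond a b (Lit 0)"

definition leE :: "expr \<Rightarrow> expr \<Rightarrow> expr" where
  "leE a b = notE (Minus a b)"

definition eqE :: "expr \<Rightarrow> expr \<Rightarrow> expr" where
  "eqE a b = notE (Plus (Minus a b) (Minus b a))"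

text \<open>A recursion of one round with start value \<open>a\<close>; its counter 48 is 0 in the
  body.\<close>

definition letE :: "nat \<Rightarrow> expr \<Rightarrow> expr \<Rightarrow> expr" where
  "letE x a b = Rec 48 x (Lit 1) a b"

text \<open>All sums share the accumulator 49, and nesting is safe because \<open>Rec\<close>
  restores it. For \<open>eval_sumE\<close> the summand must have the same value for every content
  of 49.\<close>

definition sumE :: "nat \<Rightarrow> expr \<Rightarrow> expr \<Rightarrow> expr" where
  "sumE i n e = Rec i 49 n (Lit 0) (Plus (Var 49) e)"

definition allE :: "nat \<Rightarrow> expr \<Rightarrow> expr \<Rightarrow> expr" where
  "allE i n e = notE (sumE i n (notE e))"

text \<open>Repeated addition of register \<open>x\<close>: only the first factor counts rounds, so
  the second may be huge.\<close>

definition mulE :: "expr \<Rightarrow> nat \<Rightarrow> expr" where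
  "mulE a x = Rec 42 43 a (Lit 0) (Plus (Var 43) (Var x))"

definition pow2E :: "expr \<Rightarrow> expr" where
  "pow2E e = Rec 42 43 e (Lit 1) (Plus (Var 43) (Var 43))"

definition powE :: "nat \<Rightarrow> expr \<Rightarrow> expr" where
  "powE x e = Rec 40 41 e (Lit 1) (mulE (Var x) 41)"

text \<open>For a positive divisor, the quotient is the number of positive multiples of the divisor
  that do not exceed the dividend.\<close>

definition divE :: "nat \<Rightarrow> nat \<Rightarrow> expr" where
  "divE x y = sumE 44 (Var x) (leE (mulE (Plus (Var 44) (Lit 1)) y) (Var x))"

lemma rec_nat_add: "rec_nat 0 (\<lambda>j acc. acc + f j) n = (\<Sum>j<n. f j)" for f :: "nat \<Rightarrow> nat"
  by (induction n) auto

lemma rec_nat_add_const: "rec_nat 0 (\<lambda>j acc. acc + c) n = n * c" for c :: nat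
  by (induction n) auto

lemma rec_nat_double: "rec_nat (Suc 0) (\<lambda>j acc. acc + acc) n = 2 ^ n"
  by (induction n) auto

lemma rec_nat_mult: "rec_nat (Suc 0) (\<lambda>j acc. c * acc) n = c ^ n" for c :: nat
  by (induction n) auto

lemma eval_notE [simp]: "eval (notE e) R M = of_bool (eval e R M = 0)"
  by (simp add: notE_def)

lemma eval_andE [simp]: "eval (andE a b) R M = (if eval a R M \<noteq> 0 then eval b R M else 0)"
  by (simp add: andE_def)

lemma eval_leE [simp]: "eval (leE a b) R M = of_bool (eval a R M \<le> eval b R M)"
  by (simp add: leE_def)

lemma eval_eqE [simp]: "eval (eqE a b) R M = of_bool (eval a R M = eval b R M)"
  by (auto simp: eqE_def)

lemma eval_letE [simp]: "eval (letE x a b) R M = eval b (R(48 := 0, x := eval a R M)) M"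
  by (simp add: letE_def)

lemma eval_mulE [simp]: "x \<notin> {42, 43} \<Longrightarrow> eval (mulE a x) R M = eval a R M * R x"
  by (simp add: mulE_def rec_nat_add_const)

lemma eval_pow2E [simp]: "eval (pow2E e) R M = 2 ^ eval e R M"
  by (simp add: pow2E_def rec_nat_double)

lemma eval_powE [simp]: "x \<notin> {40, 41, 42, 43} \<Longrightarrow> eval (powE x e) R M = R x ^ eval e R M"
  by (simp add: powE_def rec_nat_mult)

lemma eval_sumE:
  "(\<And>j acc. eval e (R(i := j, 49 := acc)) M = f j) \<Longrightarrow> eval (sumE i n e) R M = (\<Sum>j<eval n R M. f j)"
  by (simp add: sumE_def rec_nat_add)

lemma eval_allE:
  assumes "\<And>j acc. eval e (R(i := j, 49 := acc)) M = of_bool (P j)"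
  shows "eval (allE i n e) R M = of_bool (\<forall>j<eval n R M. P j)"
  unfolding allE_def eval_notE
  by (subst eval_sumE[where f = "\<lambda>j. of_bool (\<not> P j)"]) (auto simp: assms)

lemma sum_le_div: "(\<Sum>j<c. of_bool (Suc j * q \<le> c)) = c div q" if "q > 0" for c q :: nat
proof -
  have "{j. j < c \<and> Suc j * q \<le> c} = {..<c div q}"
    using that less_eq_div_iff_mult_less_eq[of q "Suc _" c] order.strict_trans2[OF _ div_le_dividend[of c q]]
    by (auto simp: Suc_le_eq simp del: mult_Suc)
  moreover have "(\<Sum>j<c. of_bool (Suc j * q \<le> c)) = card {j. j < c \<and> Suc j * q \<le> c}"
    by (simp add: sum.If_cases of_bool_def Int_def)
  ultimately show ?thesis
    by simp
qed

lemma eval_divE [simp]: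
  assumes "x \<notin> {42, 43, 44, 49}" "y \<notin> {42, 43, 44, 49}" "R y > 0"
  shows "eval (divE x y) R M = R x div R y"
  unfolding divE_def sum_le_div[OF assms(3), symmetric]
  by (subst eval_sumE[where f = "\<lambda>j. of_bool (Suc j * R y \<le> R x)"]) (use assms in auto)

lemma bounded_notE [simp]: "bounded m (notE e) R M \<longleftrightarrow> bounded m e R M"
  by (simp add: notE_def)

lemma bounded_andE [simp]:
  "bounded m (andE a b) R M \<longleftrightarrow> bounded m a R M \<and> (eval a R M \<noteq> 0 \<longrightarrow> bounded m b R M)"
  by (simp add: andE_def)

lemma bounded_leE [simp]: "bounded m (leE a b) R M \<longleftrightarrow> bounded m a R M \<and> bounded m b R M"
  by (simp add: leE_def)

lemma bounded_eqE [simp]: "bounded m (eqE a b) R M \<longleftrightarrow> bounded m a R M \<and> bounded m b R M"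
  by (auto simp: eqE_def)

lemma bounded_letE [simp]:
  "m > 0 \<Longrightarrow> bounded m (letE x a b) R M \<longleftrightarrow> bounded m a R M \<and> bounded m b (R(48 := 0, x := eval a R M)) M"
  by (auto simp: letE_def)

lemma bounded_sumE:
  "bounded m n R M \<Longrightarrow> eval n R M \<le> m \<Longrightarrow>
    (\<And>j acc. j < eval n R M \<Longrightarrow> bounded m e (R(i := j, 49 := acc)) M) \<Longrightarrow> bounded m (sumE i n e) R M"
  by (simp add: sumE_def)

lemma bounded_allE:
  "bounded m n R M \<Longrightarrow> eval n R M \<le> m \<Longrightarrow>
    (\<And>j acc. j < eval n R M \<Longrightarrow> bounded m e (R(i := j, 49 := acc)) M) \<Longrightarrow> bounded m (allE i n e) R M"
  by (simp add: allE_def bounded_sumE)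

lemma bounded_mulE [simp]: "bounded m (mulE a x) R M \<longleftrightarrow> bounded m a R M \<and> eval a R M \<le> m"
  by (simp add: mulE_def)

lemma bounded_pow2E [simp]: "bounded m (pow2E a) R M \<longleftrightarrow> bounded m a R M \<and> eval a R M \<le> m"
  by (simp add: pow2E_def)

lemma bounded_powE:
  "x \<notin> {40, 41, 42, 43} \<Longrightarrow> bounded m e R M \<Longrightarrow> eval e R M \<le> m \<Longrightarrow> R x \<le> m \<Longrightarrow> bounded m (powE x e) R M"
  by (simp add: powE_def)

lemma bounded_divE:
  "x \<notin> {42, 43, 44, 49} \<Longrightarrow> y \<notin> {42, 43, 44, 49} \<Longrightarrow> R x \<le> m \<Longrightarrow> bounded m (divE x y) R M"
  by (auto simp: divE_def intro!: bounded_sumE)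

text \<open>
  Registers: 0 parameter, 1 length of the string, 2 number \<open>n\<close> of vertices, 3 bound \<open>l\<close>, 4 and 5
  start and target, 6 base, 7 number coding a walk, 8 position in the walk, 9 current set, 10
  current digit, 11 to 13 candidate move and resulting set, 14 to 16 the same for the competing
  moves in \<open>rankE\<close>, 17 and 18 vertices in \<open>allianceE\<close>, 26 position where the digits of \<open>l\<close>
  start; the others are auxiliary. A vertex set is coded by \<open>set_encode\<close>.

  The machine can neither divide nor shift, so bit \<open>v\<close> of a number below \<open>2 ^ n\<close> is found by
  removing the leading bits \<open>n - 1, \<dots>, v + 1\<close>.
\<close>

definition bitE :: "expr \<Rightarrow> expr \<Rightarrow> expr" where
  "bitE a v = leE (pow2E v) (Rec 40 41 (Minus (Var 2) (Plus v (Lit 1))) a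
     (let w = pow2E (Minus (Minus (Var 2) (Lit 1)) (Var 40))
      in Cond (leE w (Var 41)) (Minus (Var 41) w) (Var 41)))"

definition has_bit :: "nat \<Rightarrow> nat \<Rightarrow> nat \<Rightarrow> bool" where
  "has_bit n a v \<longleftrightarrow> 2 ^ v \<le>
     rec_nat a (\<lambda>j acc. if 2 ^ (n - Suc j) \<le> acc then acc - 2 ^ (n - Suc j) else acc) (n - Suc v)"

lemma eval_bitE [simp]:
  "eval (bitE a v) R M = of_bool (has_bit (R 2) (eval a R M) (eval v R M))"
  by (simp add: bitE_def has_bit_def Let_def cong: if_cong)

lemma bounded_bitE:
  "bounded m a R M \<Longrightarrow> bounded m v R M \<Longrightarrow> eval v R M \<le> m \<Longrightarrow> R 2 \<le> m \<Longrightarrow> bounded m (bitE a v) R M"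
  by (auto simp: bitE_def Let_def intro: order_trans[OF diff_le_self])

text \<open>The offset \<open>3 * n + 1\<close> skips the unary \<open>n\<close>, its terminating
  zero and the two characteristic vectors.\<close>

definition adjE :: "nat \<Rightarrow> nat \<Rightarrow> expr" where
  "adjE u v = notE (notE (Mem (Plus (Plus (mulE (Lit 3) 2) (Lit 1)) (Plus (mulE (Var u) 2) (Var v)))))"

definition adjacent :: "nat \<Rightarrow> (nat \<Rightarrow> nat) \<Rightarrow> nat \<Rightarrow> nat \<Rightarrow> bool" where
  "adjacent n M u v \<longleftrightarrow> M (3 * n + 1 + (u * n + v)) \<noteq> 0"

lemma eval_adjE [simp]: "eval (adjE u v) R M = of_bool (adjacent (R 2) M (R u) (R v))"
  by (simp add: adjE_def adjacent_def)

text \<open>Multiplying by \<open>Lit 3\<close> takes three rounds, hence the recurring assumption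
  \<open>3 \<le> m\<close>.\<close>

lemma bounded_adjE: "3 \<le> m \<Longrightarrow> R u \<le> m \<Longrightarrow> bounded m (adjE u v) R M"
  by (simp add: adjE_def)

definition degE :: "expr \<Rightarrow> expr" where
  "degE e = sumE 18 (Var 2) (andE (adjE 17 18) e)"

definition degree_in :: "nat \<Rightarrow> (nat \<Rightarrow> nat) \<Rightarrow> nat \<Rightarrow> nat \<Rightarrow> nat" where
  "degree_in n M a x = (\<Sum>y<n. of_bool (adjacent n M x y \<and> has_bit n a y))"

definition degree_out :: "nat \<Rightarrow> (nat \<Rightarrow> nat) \<Rightarrow> nat \<Rightarrow> nat \<Rightarrow> nat" where
  "degree_out n M a x = (\<Sum>y<n. of_bool (adjacent n M x y \<and> \<not> has_bit n a y))"

definition allianceE :: "bool \<Rightarrow> nat \<Rightarrow> expr" where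
  "allianceE off a =
     (let i = degE (bitE (Var a) (Var 18)); e = degE (notE (bitE (Var a) (Var 18)))
      in allE 17 (Var 2) (Cond (bitE (Var a) (Var 17))
           (if off then Lit 1 else leE e (Plus i (Lit 1)))
           (if off then Cond i (leE (Plus e (Lit 1)) i) (Lit 1) else Lit 1)))"

text \<open>In the offensive case a vertex outside the set is constrained only if it has a neighbour
  inside. In a symmetric graph these are exactly the boundary vertices, so the boundary is never
  computed.\<close>

definition alliance :: "bool \<Rightarrow> nat \<Rightarrow> (nat \<Rightarrow> nat) \<Rightarrow> nat \<Rightarrow> bool" where
  "alliance off n M a \<longleftrightarrow> (\<forall>x<n.
     if has_bit n a x then off \<or> degree_out n M a x \<le> degree_in n M a x + 1
     else off \<longrightarrow> degree_in n M a x \<noteq> 0 \<longrightarrow> degree_out n M a x + 1 \<le> degree_in n M a x)"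

lemma eval_allianceE [simp]:
  assumes "a \<notin> {17, 18, 49}"
  shows "eval (allianceE off a) R M = of_bool (alliance off (R 2) M (R a))"
proof -
  have i: "eval (degE (bitE (Var a) (Var 18))) (R(17 := x, 49 := acc)) M = degree_in (R 2) M (R a) x"
    for x acc
    unfolding degE_def degree_in_def
    by (subst eval_sumE[where f = "\<lambda>y. of_bool (adjacent (R 2) M x y \<and> has_bit (R 2) (R a) y)"])
      (use assms in auto)
  have e: "eval (degE (notE (bitE (Var a) (Var 18)))) (R(17 := x, 49 := acc)) M = degree_out (R 2) M (R a) x"
    for x acc
    unfolding degE_def degree_out_def
    by (subst eval_sumE[where f = "\<lambda>y. of_bool (adjacent (R 2) M x y \<and> \<not> has_bit (R 2) (R a) y)"])
      (use assms in auto)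
  show ?thesis
    unfolding allianceE_def alliance_def Let_def
    by (subst eval_allE[OF _, where P = "\<lambda>x.
        if has_bit (R 2) (R a) x then off \<or> degree_out (R 2) M (R a) x \<le> degree_in (R 2) M (R a) x + 1
        else off \<longrightarrow> degree_in (R 2) M (R a) x \<noteq> 0 \<longrightarrow> degree_out (R 2) M (R a) x + 1 \<le> degree_in (R 2) M (R a) x"])
      (use assms in \<open>auto simp: i e\<close>)
qed

lemma bounded_allianceE:
  assumes "3 \<le> m" "R 2 \<le> m"
  shows "bounded m (allianceE off a) R M"
proof -
  have "bounded m (degE (bitE (Var a) (Var 18))) R' M"
    "bounded m (degE (notE (bitE (Var a) (Var 18)))) R' M" if "R' 2 \<le> m" "R' 17 \<le> m" for R'
    unfolding degE_def using that assms(1) by (auto intro!: bounded_sumE bounded_bitE bounded_adjE)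
  then show ?thesis
    unfolding allianceE_def Let_def
    using assms by (auto intro!: bounded_allE bounded_bitE)
qed

section \<open>Token moves ordered by rank\<close>

definition slideE :: "nat \<Rightarrow> nat \<Rightarrow> expr" where
  "slideE u v = Minus (Plus (Var 9) (pow2E (Var v))) (pow2E (Var u))"

definition validE :: "bool \<Rightarrow> nat \<Rightarrow> nat \<Rightarrow> nat \<Rightarrow> expr" where
  "validE off u v b = andE (adjE u v) (andE (bitE (Var 9) (Var u))
     (andE (notE (bitE (Var 9) (Var v))) (allianceE off b)))"

definition slide :: "nat \<Rightarrow> nat \<Rightarrow> nat \<Rightarrow> nat" where
  "slide a u v = a + 2 ^ v - 2 ^ u"

definition valid :: "bool \<Rightarrow> nat \<Rightarrow> (nat \<Rightarrow> nat) \<Rightarrow> nat \<Rightarrow> nat \<Rightarrow> nat \<Rightarrow> bool" where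
  "valid off n M a u v \<longleftrightarrow>
     adjacent n M u v \<and> has_bit n a u \<and> \<not> has_bit n a v \<and> alliance off n M (slide a u v)"

definition rankE :: "bool \<Rightarrow> expr" where
  "rankE off = sumE 14 (Var 2) (sumE 15 (Var 2) (letE 16 (slideE 14 15)
     (andE (leE (Plus (Var 16) (Lit 1)) (Var 13)) (validE off 14 15 16))))"

text \<open>Moves are ordered by the code of the resulting set. Counting the smaller results
  replaces a stored and sorted list of successors.\<close>

definition rank :: "bool \<Rightarrow> nat \<Rightarrow> (nat \<Rightarrow> nat) \<Rightarrow> nat \<Rightarrow> nat \<Rightarrow> nat" where
  "rank off n M a b = (\<Sum>u<n. \<Sum>v<n. of_bool (slide a u v < b \<and> valid off n M a u v))"

definition nextE :: "bool \<Rightarrow> expr" where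
  "nextE off = Rec 11 19 (Var 2) (Var 9) (Rec 12 20 (Var 2) (Var 19) (letE 13 (slideE 11 12)
     (Cond (andE (validE off 11 12 13) (eqE (rankE off) (Var 10))) (Var 13) (Var 20))))"

text \<open>The accumulator starts with \<open>a\<close> and is overwritten only by a matching move,
  so a digit that is no rank means standing still.\<close>

definition successor :: "bool \<Rightarrow> nat \<Rightarrow> (nat \<Rightarrow> nat) \<Rightarrow> nat \<Rightarrow> nat \<Rightarrow> nat" where
  "successor off n M a d =
     rec_nat a (\<lambda>u acc. rec_nat acc (\<lambda>v acc'.
       if valid off n M a u v \<and> rank off n M a (slide a u v) = d then slide a u v else acc') n) n"

lemma eval_slideE [simp]: "eval (slideE u v) R M = slide (R 9) (R u) (R v)"
  by (simp add: slideE_def slide_def)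

lemma eval_validE:
  assumes "b \<notin> {17, 18, 49}" "R b = slide (R 9) (R u) (R v)"
  shows "eval (validE off u v b) R M = of_bool (valid off (R 2) M (R 9) (R u) (R v))"
  using assms by (simp add: validE_def valid_def)

lemma bounded_validE:
  "3 \<le> m \<Longrightarrow> R 2 \<le> m \<Longrightarrow> R u \<le> m \<Longrightarrow> R v \<le> m \<Longrightarrow> bounded m (validE off u v b) R M"
  by (auto simp: validE_def intro!: bounded_adjE bounded_bitE bounded_allianceE)

lemma eval_rankE [simp]: "eval (rankE off) R M = rank off (R 2) M (R 9) (R 13)"
proof -
  have "eval (sumE 15 (Var 2) (letE 16 (slideE 14 15)
      (andE (leE (Plus (Var 16) (Lit 1)) (Var 13)) (validE off 14 15 16)))) (R(14 := u, 49 := acc)) M =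
      (\<Sum>v<R 2. of_bool (slide (R 9) u v < R 13 \<and> valid off (R 2) M (R 9) u v))" for u acc
    by (subst eval_sumE[where f = "\<lambda>v. of_bool (slide (R 9) u v < R 13 \<and> valid off (R 2) M (R 9) u v)"])
      (auto simp: eval_validE)
  then show ?thesis
    unfolding rankE_def rank_def by (subst eval_sumE) auto
qed

lemma bounded_slideE: "R u \<le> m \<Longrightarrow> R v \<le> m \<Longrightarrow> bounded m (slideE u v) R M"
  by (simp add: slideE_def)

lemma bounded_rankE: "3 \<le> m \<Longrightarrow> R 2 \<le> m \<Longrightarrow> bounded m (rankE off) R M"
  unfolding rankE_def by (auto intro!: bounded_sumE bounded_validE bounded_slideE)

lemma eval_nextE [simp]: "eval (nextE off) R M = successor off (R 2) M (R 9) (R 10)"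
proof -
  have [simp]: "0 < (if P then x else 0) \<longleftrightarrow> P \<and> 0 < x" for P and x :: nat
    by simp
  show ?thesis
    by (simp add: nextE_def successor_def eval_validE cong: if_cong)
qed

lemma bounded_nextE:
  assumes "3 \<le> m" "R 2 \<le> m"
  shows "bounded m (nextE off) R M"
  using assms unfolding nextE_def
  by (auto intro!: bounded_slideE bounded_validE bounded_rankE)

section \<open>Walks coded by digits\<close>

definition digitE :: expr where
  "digitE = letE 21 (powE 6 (Var 8)) (letE 22 (divE 7 21)
     (letE 23 (divE 22 6) (Minus (Var 22) (mulE (Var 23) 6))))"

definition digit :: "nat \<Rightarrow> nat \<Rightarrow> nat \<Rightarrow> nat" where
  "digit B c i = c div B ^ i mod B"

lemma eval_digitE [simp]:
  "R 6 > 0 \<Longrightarrow> eval digitE R M = digit (R 6) (R 7) (R 8)"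
  by (simp add: digitE_def digit_def modulo_nat_def)

lemma bounded_digitE:
  assumes "3 \<le> m" "0 < R 6" "R 6 \<le> m" "R 7 \<le> m" "R 8 \<le> m"
  shows "bounded m digitE R M"
proof -
  have "R 7 div R 6 ^ R 8 \<le> m" "R 7 div R 6 ^ R 8 div R 6 \<le> m"
    using assms by (meson div_le_dividend order_trans)+
  then show ?thesis
    unfolding digitE_def using assms by (simp add: bounded_powE bounded_divE)
qed

text \<open>Counts the successful walks. They have \<open>l - 1\<close> moves because
  \<open>l\<close> bounds the number of sets.\<close>

definition searchE :: "bool \<Rightarrow> expr" where
  "searchE off = sumE 7 (powE 6 (Var 3))
     (eqE (Rec 8 9 (Minus (Var 3) (Lit 1)) (Var 4) (letE 10 digitE (nextE off))) (Var 5))"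

definition walk :: "bool \<Rightarrow> nat \<Rightarrow> (nat \<Rightarrow> nat) \<Rightarrow> nat \<Rightarrow> nat \<Rightarrow> nat \<Rightarrow> nat \<Rightarrow> nat" where
  "walk off n M B c a i = rec_nat a (\<lambda>i a. successor off n M a (digit B c i)) i"

lemma eval_searchE:
  assumes "R 6 > 0"
  shows "eval (searchE off) R M \<noteq> 0 \<longleftrightarrow>
    (\<exists>c<R 6 ^ R 3. walk off (R 2) M (R 6) c (R 4) (R 3 - 1) = R 5)"
  unfolding searchE_def
  by (subst eval_sumE[where f = "\<lambda>c. of_bool (walk off (R 2) M (R 6) c (R 4) (R 3 - 1) = R 5)"])
    (use assms in \<open>auto simp: walk_def\<close>)

lemma bounded_searchE:
  assumes "3 \<le> m" "0 < R 6" "R 6 \<le> m" "R 2 \<le> m" "R 3 \<le> m" "R 6 ^ R 3 \<le> m"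
  shows "bounded m (searchE off) R M"
  unfolding searchE_def
  using assms by (auto intro!: bounded_sumE bounded_powE bounded_digitE bounded_nextE)


section \<open>Decoding the input and the complete test\<close>

definition verticesE :: expr where
  "verticesE = sumE 24 (Var 1) (allE 25 (Plus (Var 24) (Lit 1)) (notE (notE (Mem (Var 25)))))"

definition vertices :: "(nat \<Rightarrow> nat) \<Rightarrow> nat \<Rightarrow> nat" where
  "vertices M L = (\<Sum>i<L. of_bool (\<forall>j<Suc i. M j \<noteq> 0))"

definition boundE :: expr where
  "boundE = Rec 27 28 (Minus (Var 1) (Var 26)) (Lit 0)
     (Plus (Plus (Var 28) (Var 28)) (Mem (Minus (Minus (Var 1) (Lit 1)) (Var 27))))"

text \<open>Horner evaluation from the most significant bit, which is the last symbol of the string.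
  The result may be exponential in \<open>L\<close>, but the number of rounds is at most
  \<open>L\<close>.\<close>

definition bound :: "(nat \<Rightarrow> nat) \<Rightarrow> nat \<Rightarrow> nat \<Rightarrow> nat" where
  "bound M L k = rec_nat 0 (\<lambda>j acc. acc + acc + M (L - Suc j)) (L - k)"

definition codeE :: "expr \<Rightarrow> expr" where
  "codeE e = sumE 29 (Var 2) (Cond (Mem (Plus e (Var 29))) (pow2E (Var 29)) (Lit 0))"

definition code :: "nat \<Rightarrow> (nat \<Rightarrow> nat) \<Rightarrow> nat \<Rightarrow> nat" where
  "code n M k = (\<Sum>v<n. if M (k + v) \<noteq> 0 then 2 ^ v else 0)"

definition sizeE :: "expr \<Rightarrow> expr" where
  "sizeE e = sumE 29 (Var 2) (notE (notE (Mem (Plus e (Var 29)))))"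

definition symmetricE :: expr where
  "symmetricE = allE 11 (Var 2) (allE 12 (Var 2) (notE (andE (adjE 11 12)
     (notE (andE (adjE 12 11) (notE (eqE (Var 11) (Var 12))))))))"

definition baseE :: expr where
  "baseE = letE 30 (mulE (Var 0) 0) (Plus (mulE (Lit 3) 30) (Lit 1))"

text \<open>The order matters: \<open>andE\<close> is lazy, so the search runs only after the test
  \<open>k + l = p\<close> has forced \<open>l \<le> p\<close>. The target gets no alliance test of
  its own, since a walk from an alliance passes only through alliances of the same size.\<close>

definition checkE :: "bool \<Rightarrow> expr" where
  "checkE off = andE (eqE (Plus (sizeE (Plus (Var 2) (Lit 1))) (Var 3)) (Var 0))
     (andE (leE (Lit 1) (Var 3)) (andE symmetricE (andE (allianceE off 4) (notE (notE (searchE off))))))"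

definition mainE :: "bool \<Rightarrow> expr" where
  "mainE off = letE 2 verticesE
     (letE 26 (Plus (Plus (mulE (Lit 3) 2) (Lit 1)) (mulE (Var 2) 2))
     (andE (andE (leE (Var 26) (Var 1)) (Cond (Minus (Var 1) (Var 26)) (Mem (Minus (Var 1) (Lit 1))) (Lit 1)))
     (letE 3 boundE (letE 4 (codeE (Plus (Var 2) (Lit 1)))
     (letE 5 (codeE (Plus (mulE (Lit 2) 2) (Lit 1))) (letE 6 baseE (checkE off)))))))"

definition base :: "nat \<Rightarrow> nat" where
  "base p = 3 * (p * p) + 1"

definition accepts :: "bool \<Rightarrow> (nat \<Rightarrow> nat) \<Rightarrow> nat \<Rightarrow> nat \<Rightarrow> bool" where
  "accepts off M L p \<longleftrightarrow>
     (let n = vertices M L; k = 3 * n + 1 + n * n; l = bound M L k; s = code n M (n + 1) in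
        k \<le> L \<and> (L \<noteq> k \<longrightarrow> M (L - 1) \<noteq> 0) \<and>
        (\<Sum>v<n. of_bool (M (n + 1 + v) \<noteq> 0)) + l = p \<and> 1 \<le> l \<and>
        (\<forall>u<n. \<forall>v<n. adjacent n M u v \<longrightarrow> adjacent n M v u \<and> u \<noteq> v) \<and>
        alliance off n M s \<and>
        (\<exists>c<base p ^ l. walk off n M (base p) c s (l - 1) = code n M (2 * n + 1)))"

lemma eval_verticesE [simp]: "eval verticesE R M = vertices M (R 1)"
proof -
  have "eval (allE 25 (Plus (Var 24) (Lit 1)) (notE (notE (Mem (Var 25))))) (R(24 := i, 49 := acc)) M =
      of_bool (\<forall>j<Suc i. M j \<noteq> 0)" for i acc
    by (subst eval_allE[where P = "\<lambda>j. M j \<noteq> 0"]) auto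
  then show ?thesis
    unfolding verticesE_def vertices_def by (subst eval_sumE) auto
qed

lemma bounded_verticesE: "R 1 \<le> m \<Longrightarrow> bounded m verticesE R M"
  by (auto simp: verticesE_def intro!: bounded_sumE bounded_allE)

lemma vertices_le: "vertices M L \<le> L"
  unfolding vertices_def by (rule order_trans[OF sum_mono[where g = "\<lambda>_. 1"]]) auto

lemma eval_boundE [simp]: "eval boundE R M = bound M (R 1) (R 26)"
  by (simp add: boundE_def bound_def)

lemma bounded_boundE: "R 1 \<le> m \<Longrightarrow> bounded m boundE R M"
  by (simp add: boundE_def)

lemma eval_codeE:
  "(\<And>j acc. eval e (R(29 := j, 49 := acc)) M = k) \<Longrightarrow> eval (codeE e) R M = code (R 2) M k"
  unfolding codeE_def code_def
  by (subst eval_sumE[where f = "\<lambda>v. if M (k + v) \<noteq> 0 then 2 ^ v else 0"]) auto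

lemma bounded_codeE:
  "R 2 \<le> m \<Longrightarrow> (\<And>j acc. bounded m e (R(29 := j, 49 := acc)) M) \<Longrightarrow> bounded m (codeE e) R M"
  unfolding codeE_def by (auto intro!: bounded_sumE)

lemma eval_sizeE:
  "(\<And>j acc. eval e (R(29 := j, 49 := acc)) M = k) \<Longrightarrow>
    eval (sizeE e) R M = (\<Sum>v<R 2. of_bool (M (k + v) \<noteq> 0))"
  unfolding sizeE_def
  by (subst eval_sumE[where f = "\<lambda>v. of_bool (M (k + v) \<noteq> 0)"]) auto

lemma bounded_sizeE:
  "R 2 \<le> m \<Longrightarrow> (\<And>j acc. bounded m e (R(29 := j, 49 := acc)) M) \<Longrightarrow> bounded m (sizeE e) R M"
  unfolding sizeE_def by (auto intro!: bounded_sumE)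

lemma eval_symmetricE [simp]:
  "eval symmetricE R M =
    of_bool (\<forall>u<R 2. \<forall>v<R 2. adjacent (R 2) M u v \<longrightarrow> adjacent (R 2) M v u \<and> u \<noteq> v)"
proof -
  have "eval (allE 12 (Var 2) (notE (andE (adjE 11 12)
      (notE (andE (adjE 12 11) (notE (eqE (Var 11) (Var 12)))))))) (R(11 := u, 49 := acc)) M =
      of_bool (\<forall>v<R 2. adjacent (R 2) M u v \<longrightarrow> adjacent (R 2) M v u \<and> u \<noteq> v)" for u acc
    by (subst eval_allE[where P = "\<lambda>v. adjacent (R 2) M u v \<longrightarrow> adjacent (R 2) M v u \<and> u \<noteq> v"]) auto
  then show ?thesis
    unfolding symmetricE_def by (subst eval_allE) auto
qed

lemma bounded_symmetricE: "3 \<le> m \<Longrightarrow> R 2 \<le> m \<Longrightarrow> bounded m symmetricE R M"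
  unfolding symmetricE_def by (auto intro!: bounded_allE bounded_adjE)

lemma eval_baseE [simp]: "eval baseE R M = base (R 0)"
  by (simp add: baseE_def base_def)

lemma bounded_baseE: "3 \<le> m \<Longrightarrow> R 0 \<le> m \<Longrightarrow> bounded m baseE R M"
  by (simp add: baseE_def)

lemma eval_checkE:
  assumes "R 6 > 0"
  shows "eval (checkE off) R M = of_bool
    ((\<Sum>v<R 2. of_bool (M (R 2 + 1 + v) \<noteq> 0)) + R 3 = R 0 \<and> 1 \<le> R 3 \<and>
     (\<forall>u<R 2. \<forall>v<R 2. adjacent (R 2) M u v \<longrightarrow> adjacent (R 2) M v u \<and> u \<noteq> v) \<and>
     alliance off (R 2) M (R 4) \<and>
     (\<exists>c<R 6 ^ R 3. walk off (R 2) M (R 6) c (R 4) (R 3 - 1) = R 5))"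
proof -
  have "eval (sizeE (Plus (Var 2) (Lit 1))) R M = (\<Sum>v<R 2. of_bool (M (R 2 + 1 + v) \<noteq> 0))"
    by (rule eval_sizeE) simp
  moreover have "eval (notE (notE (searchE off))) R M =
      of_bool (\<exists>c<R 6 ^ R 3. walk off (R 2) M (R 6) c (R 4) (R 3 - 1) = R 5)"
    using eval_searchE[of R off M, OF assms] by simp
  ultimately show ?thesis
    by (auto simp: checkE_def simp del: eval_notE)
qed

lemma bounded_checkE:
  assumes "3 \<le> m" "R 6 > 0" "R 6 ^ (R 0 + 1) \<le> m" "R 0 \<le> m" "R 2 \<le> m"
  shows "bounded m (checkE off) R M"
proof -
  \<comment> \<open>The guard supplies \<open>R 3 \<le> R 0\<close>. Then
    \<open>R 6 ^ (R 0 + 1)\<close> dominates the number of walks and, by comparison with exponent 1,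
    also the base itself.\<close>
  have "bounded m (searchE off) R M" if "R 3 \<le> R 0"
  proof (rule bounded_searchE)
    have "R 6 ^ 1 \<le> R 6 ^ (R 0 + 1)" "R 6 ^ R 3 \<le> R 6 ^ (R 0 + 1)"
      using that assms by (intro power_increasing; simp)+
    then show "R 6 \<le> m" "R 6 ^ R 3 \<le> m"
      using assms(3) unfolding power_one_right by linarith+
  qed (use assms that in auto)
  moreover have "eval (sizeE (Plus (Var 2) (Lit 1))) R M = (\<Sum>v<R 2. of_bool (M (R 2 + 1 + v) \<noteq> 0))"
    by (rule eval_sizeE) simp
  ultimately show ?thesis
    unfolding checkE_def using assms
    by (auto intro!: bounded_sizeE bounded_symmetricE bounded_allianceE)
qed

theorem eval_mainE:
  assumes "R 0 = p" "R 1 = L"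
  shows "eval (mainE off) R M = of_bool (accepts off M L p)"
  using assms
  by (simp add: mainE_def accepts_def Let_def eval_codeE[where k = "Suc (vertices M L)"]
      eval_codeE[where k = "Suc (2 * vertices M L)"] eval_checkE base_def)

theorem bounded_mainE:
  assumes "3 \<le> m" "R 0 \<le> m" "R 1 \<le> m" "base (R 0) ^ (R 0 + 1) \<le> m"
  shows "bounded m (mainE off) R M"
proof -
  have "vertices M (R 1) \<le> m"
    using vertices_le assms(3) order_trans by blast
  then show ?thesis
    using assms unfolding mainE_def
    by (auto simp: base_def intro!: bounded_verticesE bounded_boundE bounded_codeE bounded_baseE bounded_checkE)
qed

lemma below_mainE: "below 50 (mainE off)"
  by (simp add: mainE_def verticesE_def boundE_def codeE_def sizeE_def symmetricE_def baseE_def checkE_def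
      searchE_def digitE_def nextE_def rankE_def validE_def slideE_def allianceE_def degE_def adjE_def
      bitE_def divE_def powE_def pow2E_def mulE_def allE_def sumE_def letE_def eqE_def leE_def andE_def
      notE_def Let_def)

section \<open>Reading an encoded instance\<close>

definition memory :: "bool list \<Rightarrow> nat \<Rightarrow> nat" where
  "memory x i = (if i < length x then of_bool (x ! i) else 0)"

lemma horner_sum_pos: "bs \<noteq> [] \<Longrightarrow> last bs \<Longrightarrow> horner_sum of_bool 2 bs > (0 :: nat)"
  by (induction bs) (auto split: if_splits)

lemma horner_sum_nat_bits: "horner_sum of_bool 2 (nat_bits n) = n"
proof (induction n rule: less_induct)
  case (less n)
  then show ?case
    by (cases "n = 0") (simp_all add: nat_bits.simps[of n] nat_bits.simps[of 0] of_bool_odd_eq_mod_2)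
qed

lemma last_nat_bits: "n \<noteq> 0 \<Longrightarrow> last (nat_bits n)"
proof (induction n rule: less_induct)
  case (less n)
  show ?case
  proof (cases "n div 2 = 0")
    case True
    then have "n = 1" using less.prems by linarith
    then show ?thesis by (simp add: nat_bits.simps)
  next
    case False
    then have "last (nat_bits (n div 2))" "nat_bits (n div 2) \<noteq> []"
      using less.IH[of "n div 2"] less.prems by (simp_all add: nat_bits.simps[of "n div 2"])
    then show ?thesis
      using less.prems by (simp add: nat_bits.simps[of n])
  qed
qed

lemma nat_bits_horner_sum: "(bs \<noteq> [] \<longrightarrow> last bs) \<Longrightarrow> nat_bits (horner_sum of_bool 2 bs) = bs"
proof (induction bs)
  case Nil
  then show ?case by (simp add: nat_bits.simps)
next
  case (Cons b bs)
  let ?m = "horner_sum of_bool 2 bs :: nat"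
  have "of_bool b + 2 * ?m > (0 :: nat)"
    using horner_sum_pos[of "b # bs"] Cons.prems by simp
  moreover have "(of_bool b + 2 * ?m) div 2 = ?m" "odd (of_bool b + 2 * ?m) \<longleftrightarrow> b"
    by (cases b; simp)+
  moreover have "nat_bits ?m = bs"
    using Cons by (auto split: if_splits)
  ultimately show ?case
    by (simp add: nat_bits.simps[of "of_bool b + 2 * ?m"])
qed

lemma eq_nat_bits_iff:
  "bs = nat_bits n \<longleftrightarrow> (bs \<noteq> [] \<longrightarrow> last bs) \<and> horner_sum of_bool 2 bs = n"
proof
  assume bs: "bs = nat_bits n"
  have "n \<noteq> 0" if "bs \<noteq> []"
    using that bs nat_bits.simps[of 0] by (cases "n = 0") auto
  then show "(bs \<noteq> [] \<longrightarrow> last bs) \<and> horner_sum of_bool 2 bs = n"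
    using last_nat_bits horner_sum_nat_bits bs by simp
next
  assume "(bs \<noteq> [] \<longrightarrow> last bs) \<and> horner_sum of_bool 2 bs = n"
  then show "bs = nat_bits n"
    using nat_bits_horner_sum[of bs] by (elim conjE) simp
qed

lemma bound_memory: "bound (memory x) (length x) k = horner_sum of_bool 2 (drop k x)"
proof -
  have "rec_nat 0 (\<lambda>j acc. acc + acc + memory x (length x - Suc j)) i =
      horner_sum of_bool 2 (drop (length x - i) x)" if "i \<le> length x" for i
    using that
  proof (induction i)
    case (Suc i)
    then have "drop (length x - Suc i) x = x ! (length x - Suc i) # drop (length x - i) x"
      using Cons_nth_drop_Suc[of "length x - Suc i" x] by (simp add: Suc_diff_Suc)
    moreover have "length x - Suc i < length x"
      using Suc.prems by linarith
    ultimately show ?case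
      using Suc by (simp add: memory_def)
  qed simp
  then show ?thesis
    unfolding bound_def by (cases "k \<le> length x") simp_all
qed

lemma vertices_eq:
  assumes "n \<le> L" "M n = 0" "\<And>i. i < n \<Longrightarrow> M i \<noteq> 0"
  shows "vertices M L = n"
proof -
  have "{i. i < L \<and> (\<forall>j<Suc i. M j \<noteq> 0)} = {..<n}"
    using assms by (force simp: less_Suc_eq_le not_less[symmetric])
  moreover have "vertices M L = card {i. i < L \<and> (\<forall>j<Suc i. M j \<noteq> 0)}"
    unfolding vertices_def by (simp add: sum.If_cases of_bool_def Int_def)
  ultimately show ?thesis
    by simp
qed

lemma vertices_memory:
  assumes "vertices (memory x) (length x) = n"
  shows "\<And>i. i < n \<Longrightarrow> memory x i \<noteq> 0" "memory x n = 0"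
proof -
  define m where "m = (LEAST i. memory x i = 0)"
  \<comment> \<open>Cells behind the string are 0, so even a string of ones has a first
    zero.\<close>
  have "memory x (length x) = 0"
    by (simp add: memory_def)
  then have "memory x m = 0" "m \<le> length x"
    unfolding m_def by (rule LeastI, rule Least_le)
  moreover have "memory x i \<noteq> 0" if "i < m" for i
    using that not_less_Least unfolding m_def by blast
  ultimately have "vertices (memory x) (length x) = m"
    by (intro vertices_eq)
  then show "\<And>i. i < n \<Longrightarrow> memory x i \<noteq> 0" "memory x n = 0"
    using assms \<open>memory x m = 0\<close> \<open>\<And>i. i < m \<Longrightarrow> memory x i \<noteq> 0\<close> by simp_all
qed

lemma concat_map_upt:
  "concat (map (\<lambda>u. map (f u) [0..<n]) [0..<m]) = map (\<lambda>i. f (i div n) (i mod n)) [0..<m * n]"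
proof (induction m)
  case (Suc m)
  have "map (\<lambda>i. f (i div n) (i mod n)) [m * n..<m * n + n] = map (f m) [0..<n]"
    by (rule nth_equalityI) auto
  moreover have "[0..<Suc m * n] = [0..<m * n] @ [m * n..<m * n + n]"
    using upt_add_eq_append[of 0 "m * n" n] by (simp add: add.commute)
  ultimately show ?case
    using Suc by simp
qed simp

text \<open>The cases are the blocks of the encoding: unary \<open>n\<close>, separator, two vectors
  and the matrix in row-major order.\<close>

lemma all_less_split:
  fixes n :: nat
  shows "(\<forall>i<3 * n + 1 + n * n. P i) \<longleftrightarrow>
    (\<forall>i<n. P i) \<and> P n \<and> (\<forall>v<n. P (n + 1 + v)) \<and> (\<forall>v<n. P (2 * n + 1 + v)) \<and>
    (\<forall>u<n. \<forall>v<n. P (3 * n + 1 + (u * n + v)))" (is "?L \<longleftrightarrow> ?R")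
proof
  assume L: ?L
  have "3 * n + 1 + (u * n + v) < 3 * n + 1 + n * n" if "u < n" "v < n" for u v :: nat
  proof -
    have "Suc u * n \<le> n * n"
      using that by (intro mult_right_mono) auto
    then show ?thesis
      using that by simp
  qed
  then show ?R
    using L by auto
next
  assume R: ?R
  show ?L
  proof (intro allI impI)
    fix i assume i: "i < 3 * n + 1 + n * n"
    consider "i < n" | "i = n" | "n + 1 \<le> i" "i - (n + 1) < n" | "2 * n + 1 \<le> i" "i - (2 * n + 1) < n"
      | "3 * n + 1 \<le> i" by linarith
    then show "P i"
    proof cases
      case 3
      then have "P (n + 1 + (i - (n + 1)))" using R by blast
      then show ?thesis using 3 by simp
    next
      case 4
      then have "P (2 * n + 1 + (i - (2 * n + 1)))" using R by blast
      then show ?thesis using 4 by simp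
    next
      case 5
      define q where "q = i - (3 * n + 1)"
      have q: "q < n * n" "i = 3 * n + 1 + (q div n * n + q mod n)"
        using 5 i by (auto simp: q_def)
      have "n > 0"
        using q(1) by (cases n) auto
      then have "q div n < n" "q mod n < n"
        using q(1) by (simp_all add: less_mult_imp_div_less)
      then show ?thesis
        unfolding q(2) using R by blast
    qed (use R in auto)
  qed
qed

text \<open>Turns equality with an encoding into the conditions on cells that the machine tests. The
  header of length \<open>3 * n + 1 + n * n\<close> and the binary tail are compared
  separately.\<close>

lemma eq_encode_instance_iff:
  assumes "pverts G = {0..<n}"
  shows "x = encode_instance G S T l \<longleftrightarrow>
    3 * n + 1 + n * n \<le> length x \<and> vertices (memory x) (length x) = n \<and>
    (length x \<noteq> 3 * n + 1 + n * n \<longrightarrow> memory x (length x - 1) \<noteq> 0) \<and>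
    bound (memory x) (length x) (3 * n + 1 + n * n) = l \<and>
    (\<forall>v<n. v \<in> S \<longleftrightarrow> memory x (n + 1 + v) \<noteq> 0) \<and>
    (\<forall>v<n. v \<in> T \<longleftrightarrow> memory x (2 * n + 1 + v) \<noteq> 0) \<and>
    (\<forall>u<n. \<forall>v<n. (u, v) \<in> parcs G \<longleftrightarrow> adjacent n (memory x) u v)"
proof -
  let ?k = "3 * n + 1 + n * n"
  define H where "H = replicate n True @ [False] @ map (\<lambda>v. v \<in> S) [0..<n] @ map (\<lambda>v. v \<in> T) [0..<n] @
      map (\<lambda>i. (i div n, i mod n) \<in> parcs G) [0..<n * n]"
  have enc: "encode_instance G S T l = H @ nat_bits l"
    using assms by (simp add: encode_instance_def H_def concat_map_upt Let_def)
  have lenH: "length H = ?k"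
    by (simp add: H_def)
  have nthH: "\<And>i. i < n \<Longrightarrow> H ! i" "\<not> H ! n"
    "\<And>v. v < n \<Longrightarrow> H ! (n + 1 + v) \<longleftrightarrow> v \<in> S"
    "\<And>v. v < n \<Longrightarrow> H ! (2 * n + 1 + v) \<longleftrightarrow> v \<in> T"
    by (auto simp: H_def nth_append)
  have nthH': "H ! (3 * n + 1 + (u * n + v)) \<longleftrightarrow> (u, v) \<in> parcs G" if "u < n" "v < n" for u v
  proof -
    have "Suc u * n \<le> n * n"
      using that by (intro mult_right_mono) auto
    then have "u * n + v < n * n"
      using that by simp
    then show ?thesis
      using that by (simp add: H_def nth_append)
  qed
  have mem: "memory x i \<noteq> 0 \<longleftrightarrow> x ! i" if "i < length x" for i
    using that by (simp add: memory_def)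
  have "x = H @ nat_bits l \<longleftrightarrow> ?k \<le> length x \<and> take ?k x = H \<and> drop ?k x = nat_bits l"
    using lenH by (auto simp: append_eq_conv_conj eq_commute[of x])
  moreover have "take ?k x = H \<longleftrightarrow> vertices (memory x) (length x) = n \<and>
      (\<forall>v<n. v \<in> S \<longleftrightarrow> memory x (n + 1 + v) \<noteq> 0) \<and>
      (\<forall>v<n. v \<in> T \<longleftrightarrow> memory x (2 * n + 1 + v) \<noteq> 0) \<and>
      (\<forall>u<n. \<forall>v<n. (u, v) \<in> parcs G \<longleftrightarrow> adjacent n (memory x) u v)" if k: "?k \<le> length x"
  proof -
    have "take ?k x = H \<longleftrightarrow> (\<forall>i<?k. x ! i = H ! i)"
      using k lenH by (auto simp: list_eq_iff_nth_eq)
    also have "\<dots> \<longleftrightarrow> (\<forall>i<?k. memory x i \<noteq> 0 \<longleftrightarrow> H ! i)"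
      using mem k by auto
    also have "\<dots> \<longleftrightarrow> ((\<forall>i<n. memory x i \<noteq> 0) \<and> memory x n = 0) \<and>
      (\<forall>v<n. v \<in> S \<longleftrightarrow> memory x (n + 1 + v) \<noteq> 0) \<and>
      (\<forall>v<n. v \<in> T \<longleftrightarrow> memory x (2 * n + 1 + v) \<noteq> 0) \<and>
      (\<forall>u<n. \<forall>v<n. (u, v) \<in> parcs G \<longleftrightarrow> adjacent n (memory x) u v)"
      unfolding all_less_split using nthH nthH' by (simp add: adjacent_def) blast
    also have "(\<forall>i<n. memory x i \<noteq> 0) \<and> memory x n = 0 \<longleftrightarrow> vertices (memory x) (length x) = n"
      using vertices_memory[of x n] vertices_eq[of n "length x" "memory x"] k by auto
    finally show ?thesis .
  qed
  moreover have "drop ?k x = nat_bits l \<longleftrightarrow>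
      (length x \<noteq> ?k \<longrightarrow> memory x (length x - 1) \<noteq> 0) \<and> bound (memory x) (length x) ?k = l"
    if k: "?k \<le> length x"
  proof -
    have "drop ?k x \<noteq> [] \<longleftrightarrow> length x \<noteq> ?k"
      using k by auto
    moreover have "last (drop ?k x) \<longleftrightarrow> memory x (length x - 1) \<noteq> 0" if "drop ?k x \<noteq> []"
    proof -
      have "?k < length x"
        using that by simp
      then have "last (drop ?k x) = last x" "x \<noteq> []"
        by (auto intro: last_drop)
      then show ?thesis
        using mem[of "length x - 1"] by (simp add: last_conv_nth)
    qed
    ultimately show ?thesis
      unfolding eq_nat_bits_iff bound_memory by blast
  qed
  ultimately show ?thesis
    unfolding enc by blast
qed

section \<open>Vertex sets as numbers\<close>

text \<open>One round of \<open>has_bit\<close>: removing the leading bit, if present, halves the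
  modulus.\<close>

lemma mod_double: "(if q \<le> a mod (2 * q) then a mod (2 * q) - q else a mod (2 * q)) = a mod q"
  if "q > 0" for a q :: nat
proof -
  have "a mod (2 * q) mod q = a mod q"
    by (rule mod_mod_cancel) simp
  moreover have "a mod (2 * q) - q < q"
    using that mod_less_divisor[of "2 * q" a] by linarith
  ultimately show ?thesis
    by (metis le_mod_geq mod_less not_le)
qed

text \<open>After \<open>i\<close> rounds the remainder is \<open>a mod 2 ^ (n - i)\<close>; at
  modulus \<open>2 ^ Suc v\<close>, comparison with \<open>2 ^ v\<close> reads bit \<open>v\<close>.
  For \<open>v \<ge> n\<close> no round is run, and \<open>a < 2 ^ n\<close> makes the test
  fail.\<close>

lemma has_bit_iff:
  assumes "a < 2 ^ n"
  shows "has_bit n a v \<longleftrightarrow> v \<in> set_decode a"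
proof -
  have red: "rec_nat a (\<lambda>j acc. if 2 ^ (n - Suc j) \<le> acc then acc - 2 ^ (n - Suc j) else acc) i = a mod 2 ^ (n - i)"
    if "i \<le> n" for i
    using that
  proof (induction i)
    case 0
    then show ?case using assms by simp
  next
    case (Suc i)
    then have "n - i = Suc (n - Suc i)" by simp
    then show ?case
      using Suc mod_double[of "2 ^ (n - Suc i)" a] by simp
  qed
  show ?thesis
  proof (cases "v < n")
    case True
    have "2 ^ v \<le> a mod 2 ^ Suc v \<longleftrightarrow> odd (a div 2 ^ v)"
    proof -
      have "a mod 2 ^ Suc v = 2 ^ v * (a div 2 ^ v mod 2) + a mod 2 ^ v"
        using mod_mult2_eq[of a "2 ^ v" 2] by (simp add: mult.commute)
      moreover have "\<not> 2 ^ v \<le> a mod 2 ^ v"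
        by (simp add: not_le)
      ultimately show ?thesis
        by (cases "even (a div 2 ^ v)") (auto simp: odd_iff_mod_2_eq_one)
    qed
    moreover have "n - (n - Suc v) = Suc v"
      using True by simp
    ultimately show ?thesis
      using red[of "n - Suc v"] by (simp add: has_bit_def set_decode_def)
  next
    case False
    then have "a < 2 ^ v"
      using assms by (meson le_less_trans less_le_trans not_le one_le_numeral power_increasing)
    then show ?thesis
      using False by (simp add: has_bit_def set_decode_def)
  qed
qed

lemma set_encode_less: "A \<subseteq> {..<n} \<Longrightarrow> set_encode A < 2 ^ n"
proof -
  assume "A \<subseteq> {..<n}"
  then have "set_encode A \<le> (\<Sum>i\<in>{0..<n}. 2 ^ i)"
    unfolding set_encode_def by (intro sum_mono2) auto
  then show ?thesis
    unfolding sum_power2 by (rule le_less_trans) simp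
qed

lemma has_bit_set_encode: "A \<subseteq> {..<n} \<Longrightarrow> has_bit n (set_encode A) v \<longleftrightarrow> v \<in> A"
  by (simp add: has_bit_iff set_encode_less finite_subset[of A "{..<n}"])

lemma code_eq: "code n M k = set_encode {v. v < n \<and> M (k + v) \<noteq> 0}"
  unfolding code_def set_encode_def by (simp add: sum.If_cases Int_def)

lemma slide_set_encode:
  assumes "finite A" "u \<in> A" "v \<notin> A"
  shows "slide (set_encode A) u v = set_encode (insert v (A - {u}))"
proof -
  have "set_encode A = 2 ^ u + set_encode (A - {u})"
    using assms set_encode_insert[of "A - {u}" u] by (simp add: insert_absorb)
  then show ?thesis
    using assms set_encode_insert[of "A - {u}" v] by (simp add: slide_def)
qed

section \<open>Few successors\<close>

lemma card_of_bool: "(\<Sum>y<n. of_bool (P y)) = card {y. y < n \<and> P y}" for n :: nat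
  by (simp add: sum.If_cases of_bool_def Int_def)

abbreviation alliance_property :: "bool \<Rightarrow> 'a pair_pre_digraph \<Rightarrow> 'a set \<Rightarrow> bool" where
  "alliance_property off \<equiv> (if off then offensive_alliance else defensive_alliance)"

lemma card_nbrs:
  assumes "finite (pverts G)"
  shows "card (nbrs G u) = deg_in G A u + deg_in G (pverts G - A) u"
proof -
  have "finite (nbrs G u)"
    using assms by (simp add: nbrs_def)
  moreover have "nbrs G u = nbrs G u \<inter> A \<union> nbrs G u \<inter> (pverts G - A)"
    by (auto simp: nbrs_def)
  ultimately show ?thesis
    unfolding deg_in_def by (metis (no_types, lifting) Diff_disjoint Int_assoc Int_commute Int_empty_right
        card_Un_disjoint finite_Int)
qed

text \<open>
  In the offensive case the vertex \<open>u\<close> that the token leaves may have high degree in view of \<open>A\<close>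
  alone, but it is in the boundary of \<open>B\<close>.
\<close>

lemma card_nbrs_sliding_step:
  assumes G: "pair_graph G" and step: "sliding_step G A B" and u: "A - B = {u}"
    and A: "alliance_property off G A" and B: "alliance_property off G B"
  shows "card (nbrs G u) \<le> 2 * card A + 1"
proof -
  interpret pair_graph G by (rule G)
  obtain v where v: "B - A = {v}" "(u, v) \<in> parcs G" and card: "card A = card B"
    using step u by (auto simp: sliding_step_def)
  have fin: "finite A" "finite B"
    using A B by (auto simp: offensive_alliance_def defensive_alliance_def intro: finite_subset split: if_splits)
  then have le: "deg_in G A u \<le> card A" "deg_in G B u \<le> card A"
    unfolding deg_in_def by (simp add: card_mono) (simp add: card card_mono fin)
  show ?thesis
  proof (cases off)
    case True
    have "(v, u) \<in> parcs G"
      using v(2) arcs_symmetric by blast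
    then have "u \<in> boundary G B"
      using u v(1) in_arcsD1[OF v(2)] by (auto simp: boundary_def nbrs_def)
    then have "deg_in G (pverts G - B) u + 1 \<le> deg_in G B u"
      using B True by (simp add: offensive_alliance_def)
    then show ?thesis
      using card_nbrs[of G u B] le by simp
  next
    case False
    then have "deg_in G (pverts G - A) u \<le> deg_in G A u + 1"
      using A u by (auto simp: defensive_alliance_def)
    then show ?thesis
      using card_nbrs[of G u A] le by simp
  qed
qed

section \<open>The successors of an alliance\<close>

text \<open>The loop keeps the last match; as all matches yield \<open>b\<close>, only the existence
  of one counts.\<close>

lemma rec_nat_if:
  "(\<And>j. j < n \<Longrightarrow> P j \<Longrightarrow> f j = b) \<Longrightarrow>
    rec_nat z (\<lambda>j acc. if P j then f j else acc) n = (if \<exists>j<n. P j then b else z)"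
  by (induction n) (auto simp: less_Suc_eq)

lemma rank_eq:
  "rank off n M a b = card {(u, v). u < n \<and> v < n \<and> slide a u v < b \<and> valid off n M a u v}"
proof -
  have "rank off n M a b =
      (\<Sum>(u, v)\<in>{..<n} \<times> {..<n}. of_bool (slide a u v < b \<and> valid off n M a u v))"
    unfolding rank_def by (rule sum.cartesian_product)
  also have "\<dots> = card ({..<n} \<times> {..<n} \<inter> {(u, v). slide a u v < b \<and> valid off n M a u v})"
    by (simp add: case_prod_unfold of_bool_def sum.If_cases)
  also have "{..<n} \<times> {..<n} \<inter> {(u, v). slide a u v < b \<and> valid off n M a u v} =
      {(u, v). u < n \<and> v < n \<and> slide a u v < b \<and> valid off n M a u v}"
    by auto
  finally show ?thesis .
qed

lemma finite_pairs_less: "finite {(u, v). u < n \<and> v < n \<and> P u v}" for n :: nat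
  by (rule finite_subset[of _ "{..<n} \<times> {..<n}"]) auto

text \<open>The move \<open>(u, v)\<close> is counted in the rank of \<open>b\<close> but not in
  that of its own result. Hence ranks separate different results.\<close>

lemma rank_less:
  assumes "u < n" "v < n" "valid off n M a u v" "slide a u v < b"
  shows "rank off n M a (slide a u v) < rank off n M a b"
  unfolding rank_eq
proof (rule psubset_card_mono)
  show "{(u', v'). u' < n \<and> v' < n \<and> slide a u' v' < slide a u v \<and> valid off n M a u' v'}
      \<subset> {(u, v). u < n \<and> v < n \<and> slide a u v < b \<and> valid off n M a u v}"
  proof
    have "(u, v) \<in> {(u, v). u < n \<and> v < n \<and> slide a u v < b \<and> valid off n M a u v}"
      using assms by simp
    moreover have "(u, v) \<notin> {(u', v'). u' < n \<and> v' < n \<and> slide a u' v' < slide a u v \<and> valid off n M a u' v'}"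
      by simp
    ultimately show "{(u', v'). u' < n \<and> v' < n \<and> slide a u' v' < slide a u v \<and> valid off n M a u' v'}
      \<noteq> {(u, v). u < n \<and> v < n \<and> slide a u v < b \<and> valid off n M a u v}"
      by blast
  qed (use assms in auto)
qed (rule finite_pairs_less)

text \<open>No move counts itself in its rank. This bounds the digits by the number of valid
  moves.\<close>

lemma rank_less_card:
  assumes "u < n" "v < n" "valid off n M a u v"
  shows "rank off n M a (slide a u v) < card {(u, v). u < n \<and> v < n \<and> valid off n M a u v}"
  unfolding rank_eq using assms by (intro psubset_card_mono finite_pairs_less) auto

lemma successor_eq:
  assumes "\<And>u v. u < n \<Longrightarrow> v < n \<Longrightarrow> valid off n M a u v \<Longrightarrow> rank off n M a (slide a u v) = d \<Longrightarrow> slide a u v = b"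
  shows "successor off n M a d =
    (if \<exists>u<n. \<exists>v<n. valid off n M a u v \<and> rank off n M a (slide a u v) = d then b else a)"
proof -
  have inner: "rec_nat acc (\<lambda>v acc'. if valid off n M a u v \<and> rank off n M a (slide a u v) = d then slide a u v else acc') n
      = (if \<exists>v<n. valid off n M a u v \<and> rank off n M a (slide a u v) = d then b else acc)"
    if "u < n" for u acc
    by (rule rec_nat_if) (use assms that in auto)
  have "rec_nat a (\<lambda>u acc. rec_nat acc (\<lambda>v acc'.
        if valid off n M a u v \<and> rank off n M a (slide a u v) = d then slide a u v else acc') n) k =
      rec_nat a (\<lambda>u acc. if \<exists>v<n. valid off n M a u v \<and> rank off n M a (slide a u v) = d then b else acc) k"
    if "k \<le> n" for k
    using that by (induction k) (simp_all add: inner)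
  then show ?thesis
    unfolding successor_def by (simp add: rec_nat_if[where b = b and f = "\<lambda>_. b"])
qed

lemma successor_rank:
  assumes "u < n" "v < n" "valid off n M a u v"
  shows "successor off n M a (rank off n M a (slide a u v)) = slide a u v"
proof (subst successor_eq)
  fix u' v' assume "u' < n" "v' < n" "valid off n M a u' v'" "rank off n M a (slide a u' v') = rank off n M a (slide a u v)"
  then show "slide a u' v' = slide a u v"
    using rank_less assms by (metis linorder_neqE_nat order_less_irrefl)
qed (use assms in auto)

lemma successor_cases:
  "successor off n M a d = a \<and> (\<forall>u<n. \<forall>v<n. valid off n M a u v \<longrightarrow> rank off n M a (slide a u v) \<noteq> d) \<or>
   (\<exists>u<n. \<exists>v<n. valid off n M a u v \<and> rank off n M a (slide a u v) = d \<and> successor off n M a d = slide a u v)"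
proof (cases "\<exists>u<n. \<exists>v<n. valid off n M a u v \<and> rank off n M a (slide a u v) = d")
  case True
  then show ?thesis
    using successor_rank by blast
next
  case False
  then have "successor off n M a d = a"
    by (subst successor_eq[where b = a]) auto
  then show ?thesis
    using False by blast
qed

section \<open>Coded moves versus sliding steps in the graph\<close>

locale graph_in_memory =
  fixes G :: "nat pair_pre_digraph" and n :: nat and M :: "nat \<Rightarrow> nat"
  assumes graph: "pair_graph G"
    and pverts: "pverts G = {0..<n}"
    and adjacent: "u < n \<Longrightarrow> v < n \<Longrightarrow> adjacent n M u v \<longleftrightarrow> (u, v) \<in> parcs G"
begin

lemma degree_in:
  assumes "A \<subseteq> {..<n}" "x < n"
  shows "degree_in n M (set_encode A) x = deg_in G A x"
    "degree_out n M (set_encode A) x = deg_in G (pverts G - A) x"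
  unfolding degree_in_def degree_out_def card_of_bool deg_in_def nbrs_def
  using assms by (auto simp: has_bit_set_encode adjacent pverts intro!: arg_cong[where f = card])

lemma alliance_iff:
  assumes "A \<subseteq> {..<n}"
  shows "alliance off n M (set_encode A) \<longleftrightarrow> alliance_property off G A"
proof -
  interpret pair_graph G by (rule graph)
  \<comment> \<open>By symmetry, having a neighbour in \<open>A\<close> and being a neighbour of a
    member of \<open>A\<close> coincide.\<close>
  have "x \<in> boundary G A \<longleftrightarrow> x < n \<and> x \<notin> A \<and> deg_in G A x \<noteq> 0" for x
  proof -
    have "finite (nbrs G x \<inter> A)"
      using assms finite_subset by blast
    then have "deg_in G A x \<noteq> 0 \<longleftrightarrow> (\<exists>y\<in>A. y < n \<and> (x, y) \<in> parcs G)"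
      by (auto simp: deg_in_def nbrs_def pverts)
    then show ?thesis
      using assms arcs_symmetric by (auto simp: boundary_def nbrs_def pverts)
  qed
  then show ?thesis
    using assms unfolding alliance_def defensive_alliance_def offensive_alliance_def
    by (cases off) (auto simp: has_bit_set_encode degree_in pverts)
qed

lemma valid_iff:
  assumes "A \<subseteq> {..<n}" "u < n" "v < n"
  shows "valid off n M (set_encode A) u v \<longleftrightarrow>
    (u, v) \<in> parcs G \<and> u \<in> A \<and> v \<notin> A \<and> alliance_property off G (insert v (A - {u}))"
proof -
  have "finite A"
    using assms(1) finite_subset by blast
  moreover have "insert v (A - {u}) \<subseteq> {..<n}"
    using assms by auto
  ultimately have "alliance off n M (slide (set_encode A) u v) \<longleftrightarrow>
      alliance_property off G (insert v (A - {u}))" if "u \<in> A" "v \<notin> A"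
    unfolding slide_set_encode[OF \<open>finite A\<close> that] by (intro alliance_iff)
  then show ?thesis
    unfolding valid_def has_bit_set_encode[OF assms(1)] adjacent[OF assms(2,3)] by blast
qed

text \<open>Only the new set is tested; the old one is an alliance by the assumption on the start or
  by the previous step.\<close>

definition step :: "bool \<Rightarrow> nat set \<Rightarrow> nat set \<Rightarrow> bool" where
  "step off A B \<longleftrightarrow> sliding_step G A B \<and> alliance_property off G B"

lemma alliance_subset: "alliance_property off G A \<Longrightarrow> A \<subseteq> {..<n}"
  by (auto simp: defensive_alliance_def offensive_alliance_def pverts split: if_splits)

lemma valid_step:
  assumes "A \<subseteq> {..<n}" "u < n" "v < n" "valid off n M (set_encode A) u v"
  shows "step off A (insert v (A - {u}))" "slide (set_encode A) u v = set_encode (insert v (A - {u}))"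
proof -
  have *: "(u, v) \<in> parcs G" "u \<in> A" "v \<notin> A" "alliance_property off G (insert v (A - {u}))"
    using assms valid_iff by blast+
  moreover have "finite A"
    using assms(1) finite_subset by blast
  ultimately show "slide (set_encode A) u v = set_encode (insert v (A - {u}))"
    by (simp add: slide_set_encode)
  have "A - insert v (A - {u}) = {u}" "insert v (A - {u}) - A = {v}"
    using * by auto
  moreover have "card A = card (insert v (A - {u}))"
    using * \<open>finite A\<close> card_Suc_Diff1[of A u] by simp
  ultimately show "step off A (insert v (A - {u}))"
    using * unfolding step_def sliding_step_def by blast
qed

lemma stepE:
  assumes "step off A B" "A \<subseteq> {..<n}"
  obtains u v where "u < n" "v < n" "valid off n M (set_encode A) u v" "B = insert v (A - {u})"
proof -
  obtain u v where uv: "A - B = {u}" "B - A = {v}" "(u, v) \<in> parcs G" "alliance_property off G B"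
    using assms(1) by (auto simp: step_def sliding_step_def)
  have B: "B = insert v (A - {u})" and mem: "u \<in> A" "v \<notin> A" "v \<in> B"
    using uv(1,2) by blast+
  have less: "u < n" "v < n"
    using mem assms(2) alliance_subset[OF uv(4)] by auto
  have "valid off n M (set_encode A) u v"
    using uv(3,4) mem unfolding valid_iff[OF assms(2) less] B by simp
  from less this B show thesis
    by (rule that)
qed

text \<open>A valid move is an edge leaving some \<open>u\<close> in \<open>A\<close>, and
  \<open>card_nbrs_sliding_step\<close> bounds the degree of such a \<open>u\<close>. Members of
  \<open>A\<close> with higher degree, possible in the offensive case, contribute no move.\<close>

lemma card_valid:
  assumes "alliance_property off G A"
  shows "card {(u, v). u < n \<and> v < n \<and> valid off n M (set_encode A) u v} \<le> 3 * (card A * card A)"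
proof -
  note A = alliance_subset[OF assms]
  let ?U = "{u \<in> A. card (nbrs G u) \<le> 2 * card A + 1}"
  have fin: "finite A" "\<And>u. finite (nbrs G u)"
    using A finite_subset by (auto simp: nbrs_def pverts)
  have "{(u, v). u < n \<and> v < n \<and> valid off n M (set_encode A) u v} \<subseteq> Sigma ?U (nbrs G)"
  proof (rule subrelI)
    fix u v assume "(u, v) \<in> {(u, v). u < n \<and> v < n \<and> valid off n M (set_encode A) u v}"
    then have uv: "u < n" "v < n" "valid off n M (set_encode A) u v"
      by auto
    then have *: "(u, v) \<in> parcs G" "u \<in> A" "v \<notin> A"
      using valid_iff A by blast+
    have "A - insert v (A - {u}) = {u}"
      using * by auto
    then have "card (nbrs G u) \<le> 2 * card A + 1"
      using card_nbrs_sliding_step[OF graph, of A "insert v (A - {u})" u off] valid_step(1)[OF A uv] assms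
      unfolding step_def by blast
    then show "(u, v) \<in> Sigma ?U (nbrs G)"
      using * uv by (simp add: nbrs_def pverts)
  qed
  then have "card {(u, v). u < n \<and> v < n \<and> valid off n M (set_encode A) u v} \<le> card (Sigma ?U (nbrs G))"
    using fin by (intro card_mono finite_SigmaI) auto
  also have "\<dots> = (\<Sum>u\<in>?U. card (nbrs G u))"
    using fin by (intro card_SigmaI) auto
  also have "\<dots> \<le> card ?U * (2 * card A + 1)"
    using sum_bounded_above[of ?U "\<lambda>u. card (nbrs G u)" "2 * card A + 1"] by simp
  also have "\<dots> \<le> card A * (2 * card A + 1)"
    using fin by (intro mult_right_mono card_mono) auto
  \<comment> \<open>Uses \<open>k \<le> k * k\<close> for natural \<open>k\<close>, zero
    included.\<close>
  also have "\<dots> \<le> 3 * (card A * card A)"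
    by (cases "card A") auto
  finally show ?thesis .
qed

lemma successor_sound:
  assumes "A \<subseteq> {..<n}"
  shows "\<exists>B. (B = A \<or> step off A B) \<and> successor off n M (set_encode A) d = set_encode B"
  using successor_cases[of off n M "set_encode A" d]
proof (elim disjE exE conjE)
  fix u v assume uv: "u < n" "v < n" "valid off n M (set_encode A) u v"
    and "successor off n M (set_encode A) d = slide (set_encode A) u v"
  then show ?thesis
    using valid_step[OF assms uv] by auto
qed auto

lemma successor_complete:
  assumes "alliance_property off G A" "B = A \<or> step off A B" "card A \<le> p"
  shows "\<exists>d<base p. successor off n M (set_encode A) d = set_encode B"
proof -
  note A = alliance_subset[OF assms(1)]
  have "3 * (card A * card A) < base p"
    using assms(3) by (simp add: base_def less_Suc_eq_le mult_le_mono)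
  then have less: "rank off n M (set_encode A) (slide (set_encode A) u v) < 3 * (p * p)"
    if "u < n" "v < n" "valid off n M (set_encode A) u v" for u v
    using rank_less_card[OF that] card_valid[OF assms(1)] by (simp add: base_def)
  show ?thesis
  proof (cases "B = A")
    case True
    \<comment> \<open>All ranks are below \<open>3 * (p * p)\<close>, so this largest digit matches
      no move.\<close>
    have "successor off n M (set_encode A) (3 * (p * p)) = set_encode A"
      using successor_cases[of off n M "set_encode A" "3 * (p * p)"] less by fastforce
    then show ?thesis
      using True by (auto simp: base_def)
  next
    case False
    then obtain u v where uv: "u < n" "v < n" "valid off n M (set_encode A) u v" "B = insert v (A - {u})"
      using assms(2) A stepE by blast
    let ?d = "rank off n M (set_encode A) (slide (set_encode A) u v)"
    have "?d < base p"
      using less[OF uv(1-3)] by (simp add: base_def)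
    moreover have "successor off n M (set_encode A) ?d = set_encode B"
      unfolding successor_rank[OF uv(1-3)] uv(4) by (rule valid_step(2)[OF A uv(1-3)])
    ultimately show ?thesis
      by blast
  qed
qed

section \<open>Walks versus reconfiguration sequences\<close>

lemma walk_Suc: "walk off n M b c a (Suc i) = successor off n M (walk off n M b c a i) (digit b c i)"
  by (simp add: walk_def)

text \<open>Digits that match no move leave the set unchanged, so \<open>i\<close> digits give at
  most \<open>i\<close> genuine steps.\<close>

lemma walk_sound:
  assumes "S \<subseteq> {..<n}"
  shows "\<exists>A j. A \<subseteq> {..<n} \<and> j \<le> i \<and> (step off ^^ j) S A \<and> walk off n M b c (set_encode S) i = set_encode A"
proof (induction i)
  case 0
  have "(step off ^^ 0) S S" "walk off n M b c (set_encode S) 0 = set_encode S"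
    by (simp_all add: walk_def)
  then show ?case
    using assms by blast
next
  case (Suc i)
  then obtain A j where A: "A \<subseteq> {..<n}" "j \<le> i" "(step off ^^ j) S A"
      "walk off n M b c (set_encode S) i = set_encode A"
    by blast
  obtain B where B: "B = A \<or> step off A B" "successor off n M (set_encode A) (digit b c i) = set_encode B"
    using successor_sound[OF A(1)] by blast
  have walk: "walk off n M b c (set_encode S) (Suc i) = set_encode B"
    by (simp add: walk_Suc A(4) B(2))
  from B(1) show ?case
  proof
    assume "B = A"
    then show ?case
      using A walk le_SucI by blast
  next
    assume "step off A B"
    then have "(step off ^^ Suc j) S B" "B \<subseteq> {..<n}"
      using A(3) alliance_subset by (auto simp: step_def)
    moreover have "Suc j \<le> Suc i"
      using A(2) by simp
    ultimately show ?case
      using walk by blast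
  qed
qed

text \<open>Positional notation with digit 0 least significant: \<open>d 0\<close> is put in front
  of a number for the shifted digits.\<close>

lemma digits_exist:
  "(\<And>i. i < k \<Longrightarrow> d i < b) \<Longrightarrow> \<exists>c<b ^ k. \<forall>i<k. digit b c i = d i"
proof (induction k arbitrary: d)
  case (Suc k)
  obtain c where c: "c < b ^ k" "\<forall>i<k. digit b c i = d (Suc i)"
    using Suc.IH[of "\<lambda>i. d (Suc i)"] Suc.prems by auto
  have d: "d 0 < b"
    using Suc.prems by simp
  have "digit b (d 0 + b * c) 0 = d 0" "\<And>i. digit b (d 0 + b * c) (Suc i) = digit b c i"
    using d by (simp_all add: digit_def div_mult2_eq)
  then have "\<forall>i<Suc k. digit b (d 0 + b * c) i = d i"
    using c(2) by (auto simp: less_Suc_eq_0_disj)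
  moreover have "d 0 + b * c < b ^ Suc k"
  proof -
    have "d 0 + b * c < b * Suc c"
      using d by simp
    also have "\<dots> \<le> b * b ^ k"
      using c(1) by (intro mult_left_mono) auto
    finally show ?thesis by simp
  qed
  ultimately show ?case
    by blast
qed simp

lemma walk_complete:
  assumes "alliance_property off G S" "card S \<le> p" "(step off ^^ j) S T" "j \<le> k"
  shows "\<exists>c<base p ^ k. walk off n M (base p) c (set_encode S) k = set_encode T"
proof -
  obtain f where f: "f 0 = S" "f j = T" "\<And>i. i < j \<Longrightarrow> step off (f i) (f (Suc i))"
    using assms(3) unfolding relpowp_fun_conv by blast
  have f': "alliance_property off G (f i) \<and> card (f i) \<le> p" if "i \<le> j" for i
    using that
  proof (induction i)
    case (Suc i)
    then have "step off (f i) (f (Suc i))" "card (f i) \<le> p"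
      using f(3) by simp_all
    then show ?case
      unfolding step_def sliding_step_def by simp
  qed (use assms f in simp)
  \<comment> \<open>A shorter sequence is padded: from index \<open>j\<close> on, \<open>g\<close>
    stays at \<open>T\<close>.\<close>
  define g where "g i = f (min i j)" for i
  have "\<exists>d<base p. successor off n M (set_encode (g i)) d = set_encode (g (Suc i))" for i
  proof (rule successor_complete)
    show "alliance_property off G (g i)" "card (g i) \<le> p"
      using f'[of "min i j"] by (simp_all add: g_def)
    show "g (Suc i) = g i \<or> step off (g i) (g (Suc i))"
      using f(3)[of i] by (cases "i < j") (simp_all add: g_def)
  qed
  then obtain d where d: "\<And>i. d i < base p"
      "\<And>i. successor off n M (set_encode (g i)) (d i) = set_encode (g (Suc i))"
    by metis
  obtain c where c: "c < base p ^ k" "\<forall>i<k. digit (base p) c i = d i"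
    using digits_exist[of k d "base p"] d(1) by blast
  have "walk off n M (base p) c (set_encode S) i = set_encode (g i)" if "i \<le> k" for i
    using that
  proof (induction i)
    case 0
    then show ?case by (simp add: walk_def g_def f(1))
  next
    case (Suc i)
    then show ?case
      using c(2) d(2)[of i] by (simp add: walk_Suc)
  qed
  then have "walk off n M (base p) c (set_encode S) k = set_encode T"
    using assms(4) f(2) by (simp add: g_def min_def)
  then show ?thesis
    using c(1) by blast
qed

text \<open>At most \<open>l\<close> sets in a nonempty sequence means fewer than \<open>l\<close>
  steps. The start is assumed to be an alliance because \<open>step\<close> tests only the later
  sets.\<close>

lemma reconfigurable_within_iff:
  assumes "alliance_property off G S"
  shows "reconfigurable_within (alliance_property off) G S T l \<longleftrightarrow> (\<exists>j<l. (step off ^^ j) S T)"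
proof
  assume "reconfigurable_within (alliance_property off) G S T l"
  then obtain As where As: "As \<noteq> []" "hd As = S" "last As = T" "length As \<le> l"
      "\<forall>A\<in>set As. alliance_property off G A" "successively (sliding_step G) As"
    unfolding reconfigurable_within_def by blast
  have "step off (As ! i) (As ! Suc i)" if "i < length As - 1" for i
  proof -
    have "As ! Suc i \<in> set As"
      using that by simp
    then show ?thesis
      using As(5,6) that unfolding step_def successively_conv_nth by auto
  qed
  then have "(step off ^^ (length As - 1)) S T"
    unfolding relpowp_fun_conv using As(1-3)
    by (intro exI[of _ "\<lambda>i. As ! i"]) (simp add: hd_conv_nth last_conv_nth)
  moreover have "length As - 1 < l"
    using As(1,4) by (cases As) auto
  ultimately show "\<exists>j<l. (step off ^^ j) S T"
    by blast
next
  assume "\<exists>j<l. (step off ^^ j) S T"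
  then obtain j f where f: "j < l" "f 0 = S" "f j = T" "\<And>i. i < j \<Longrightarrow> step off (f i) (f (Suc i))"
    unfolding relpowp_fun_conv by blast
  define As where "As = map f [0..<Suc j]"
  have "alliance_property off G (f i)" if "i \<le> j" for i
    using that assms f(2,4) by (cases i) (auto simp: step_def)
  then have "\<forall>A\<in>set As. alliance_property off G A"
    by (auto simp: As_def simp del: upt_Suc)
  moreover have "successively (sliding_step G) As"
    unfolding successively_conv_nth using f(4) by (auto simp: As_def step_def simp del: upt_Suc)
  moreover have "As \<noteq> []" "hd As = S" "last As = T" "length As \<le> l"
    using f(1-3) by (simp_all add: As_def hd_map last_map del: upt_Suc)
  ultimately show "reconfigurable_within (alliance_property off) G S T l"
    unfolding reconfigurable_within_def by (intro exI[of _ As] conjI)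
qed

lemma steps_alliance:
  assumes "alliance_property off G S" "(step off ^^ j) S T"
  shows "alliance_property off G T \<and> card T = card S"
  using assms(2)
proof (induction j arbitrary: T)
  case (Suc j)
  then obtain A where "(step off ^^ j) S A" "step off A T"
    by auto
  moreover from this(2) have "alliance_property off G T" "card T = card A"
    by (simp_all add: step_def sliding_step_def)
  ultimately show ?case
    using Suc.IH[of A] by simp
qed (use assms(1) in simp)

lemma walk_iff:
  assumes "alliance_property off G S" "card S \<le> p" "T \<subseteq> {..<n}" "1 \<le> l"
  shows "(\<exists>c<base p ^ l. walk off n M (base p) c (set_encode S) (l - 1) = set_encode T) \<longleftrightarrow>
    reconfigurable_within (alliance_property off) G S T l"
proof -
  note S = alliance_subset[OF assms(1)]
  have "\<exists>j<l. (step off ^^ j) S T"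
    if "walk off n M (base p) c (set_encode S) (l - 1) = set_encode T" for c
  proof -
    from walk_sound[OF S, of "l - 1" off "base p" c, unfolded that]
    obtain A j where A: "A \<subseteq> {..<n}" "j \<le> l - 1" "(step off ^^ j) S A" "set_encode T = set_encode A"
      by (elim exE conjE)
    have "finite T" "finite A"
      using A(1) assms(3) finite_subset by blast+
    then have "T = A"
      by (intro inj_onD[OF inj_on_set_encode A(4)]) simp_all
    moreover have "j < l"
      using A(2) assms(4) by linarith
    ultimately show ?thesis
      using A(3) by blast
  qed
  moreover have "\<exists>c<base p ^ l. walk off n M (base p) c (set_encode S) (l - 1) = set_encode T"
    if step: "(step off ^^ j) S T" and j: "j < l" for j
  proof -
    have "j \<le> l - 1"
      using j by linarith
    from walk_complete[OF assms(1,2) step this]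
    obtain c where "c < base p ^ (l - 1)" "walk off n M (base p) c (set_encode S) (l - 1) = set_encode T"
      by (elim exE conjE)
    \<comment> \<open>The walk reads \<open>l - 1\<close> digits, and the \<open>base p ^ l\<close>
      codes of the search include all numbers with that many digits.\<close>
    moreover have "base p ^ (l - 1) \<le> base p ^ l"
      by (intro power_increasing) (simp_all add: base_def)
    ultimately show ?thesis
      using less_le_trans by blast
  qed
  ultimately show ?thesis
    unfolding reconfigurable_within_iff[OF assms(1)] by blast
qed

end

section \<open>Correctness and running time\<close>

lemma pair_graphI:
  fixes n :: nat
  assumes "\<And>u v. u < n \<Longrightarrow> v < n \<Longrightarrow> P u v \<Longrightarrow> P v u \<and> u \<noteq> v"
  shows "pair_graph \<lparr>pverts = {0..<n}, parcs = {(u, v). u < n \<and> v < n \<and> P u v}\<rparr>"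
proof unfold_locales
  show "symmetric (with_proj \<lparr>pverts = {0..<n}, parcs = {(u, v). u < n \<and> v < n \<and> P u v}\<rparr>)"
    using assms by (auto simp: symmetric_def arcs_ends_def arc_to_ends_def intro!: symI)
qed (use assms finite_pairs_less in auto)

text \<open>Frees the vertex count from \<open>card (pverts G)\<close>, so that the \<open>n\<close>
  read from the string can be supplied.\<close>

lemma mem_timed_reconf_TS_iff:
  "(x, p) \<in> timed_reconf_TS X \<longleftrightarrow>
    (\<exists>G n S T l. x = encode_instance G S T l \<and> pair_graph G \<and> pverts G = {0..<n} \<and>
      X G S \<and> X G T \<and> card T = card S \<and> card S + l = p \<and> reconfigurable_within X G S T l)"
proof
  assume "(x, p) \<in> timed_reconf_TS X"
  then show "\<exists>G n S T l. x = encode_instance G S T l \<and> pair_graph G \<and> pverts G = {0..<n} \<and>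
      X G S \<and> X G T \<and> card T = card S \<and> card S + l = p \<and> reconfigurable_within X G S T l"
    unfolding timed_reconf_TS_def by blast
next
  assume "\<exists>G n S T l. x = encode_instance G S T l \<and> pair_graph G \<and> pverts G = {0..<n} \<and>
      X G S \<and> X G T \<and> card T = card S \<and> card S + l = p \<and> reconfigurable_within X G S T l"
  then obtain G n S T l where "x = encode_instance G S T l" "pair_graph G" "pverts G = {0..<n}"
      "X G S" "X G T" "card T = card S" "card S + l = p" "reconfigurable_within X G S T l"
    by blast
  moreover from this(3) have "pverts G = {0..<card (pverts G)}"
    by simp
  ultimately show "(x, p) \<in> timed_reconf_TS X"
    unfolding timed_reconf_TS_def by blast
qed

theorem accepts_iff:
  "accepts off (memory x) (length x) p \<longleftrightarrow> (x, p) \<in> timed_reconf_TS (alliance_property off)"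
proof
  let ?M = "memory x"
  assume acc: "accepts off ?M (length x) p"
  define n where "n = vertices ?M (length x)"
  define k where "k = 3 * n + 1 + n * n"
  define l where "l = bound ?M (length x) k"
  define S where "S = {v. v < n \<and> ?M (n + 1 + v) \<noteq> 0}"
  define T where "T = {v. v < n \<and> ?M (2 * n + 1 + v) \<noteq> 0}"
  define G where "G = \<lparr>pverts = {0..<n}, parcs = {(u, v). u < n \<and> v < n \<and> adjacent n ?M u v}\<rparr>"
  have acc': "k \<le> length x \<and> (length x \<noteq> k \<longrightarrow> ?M (length x - 1) \<noteq> 0) \<and>
    card S + l = p \<and> 1 \<le> l \<and>
    (\<forall>u<n. \<forall>v<n. adjacent n ?M u v \<longrightarrow> adjacent n ?M v u \<and> u \<noteq> v) \<and>
    alliance off n ?M (set_encode S) \<and>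
    (\<exists>c<base p ^ l. walk off n ?M (base p) c (set_encode S) (l - 1) = set_encode T)"
    using acc unfolding accepts_def Let_def n_def[symmetric] k_def[symmetric] l_def[symmetric]
      card_of_bool code_eq S_def[symmetric] T_def[symmetric] .
  have "x = encode_instance G S T l"
    by (subst eq_encode_instance_iff[of G n])
      (use acc' in \<open>auto simp: G_def S_def T_def n_def[symmetric] k_def l_def\<close>)
  moreover have graph: "pair_graph G"
    unfolding G_def using acc' by (intro pair_graphI) blast
  interpret graph_in_memory G n ?M
    by (rule graph_in_memory.intro[OF graph]) (simp_all add: G_def)
  have "S \<subseteq> {..<n}" and T: "T \<subseteq> {..<n}"
    by (auto simp: S_def T_def)
  then have S: "alliance_property off G S"
    using acc' alliance_iff by blast
  have "card S \<le> p" "1 \<le> l"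
    using acc' by auto
  with acc' have reconf: "reconfigurable_within (alliance_property off) G S T l"
    using walk_iff[OF S _ T] by blast
  \<comment> \<open>Both properties of the target are inherited along the sequence from
    \<open>S\<close>.\<close>
  moreover have "alliance_property off G T" "card T = card S"
    using reconf steps_alliance[OF S] unfolding reconfigurable_within_iff[OF S] by blast+
  moreover note graph S reconf
  ultimately show "(x, p) \<in> timed_reconf_TS (alliance_property off)"
    unfolding mem_timed_reconf_TS_iff using acc' pverts by (intro exI conjI) simp_all
next
  let ?M = "memory x"
  assume "(x, p) \<in> timed_reconf_TS (alliance_property off)"
  then obtain G n S T l where x: "x = encode_instance G S T l" and graph: "pair_graph G"
      and pverts: "pverts G = {0..<n}" and S: "alliance_property off G S" and T: "alliance_property off G T"
      and p: "card S + l = p" and reconf: "reconfigurable_within (alliance_property off) G S T l"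
    unfolding mem_timed_reconf_TS_iff by blast
  have xs: "3 * n + 1 + n * n \<le> length x" "vertices ?M (length x) = n"
    "length x \<noteq> 3 * n + 1 + n * n \<longrightarrow> ?M (length x - 1) \<noteq> 0"
    "bound ?M (length x) (3 * n + 1 + n * n) = l"
    "\<forall>v<n. v \<in> S \<longleftrightarrow> ?M (n + 1 + v) \<noteq> 0" "\<forall>v<n. v \<in> T \<longleftrightarrow> ?M (2 * n + 1 + v) \<noteq> 0"
    "\<forall>u<n. \<forall>v<n. (u, v) \<in> parcs G \<longleftrightarrow> adjacent n ?M u v"
    using iffD1[OF eq_encode_instance_iff[OF pverts] x] by simp_all
  interpret graph_in_memory G n ?M
    by (rule graph_in_memory.intro[OF graph pverts]) (use xs(7) in blast)
  interpret G: pair_graph G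
    by (rule graph)
  have sets: "{v. v < n \<and> ?M (n + 1 + v) \<noteq> 0} = S" "{v. v < n \<and> ?M (2 * n + 1 + v) \<noteq> 0} = T"
    using xs(5,6) alliance_subset[OF S] alliance_subset[OF T] by auto
  have l: "1 \<le> l"
    using reconf unfolding reconfigurable_within_iff[OF S] by auto
  have walk: "\<exists>c<base p ^ l. walk off n ?M (base p) c (set_encode S) (l - 1) = set_encode T"
    using walk_iff[OF S _ alliance_subset[OF T] l, of p] p reconf by simp
  have all: "alliance off n ?M (set_encode S)"
    using alliance_iff[OF alliance_subset[OF S]] S by blast
  have sym: "adjacent n ?M v u \<and> u \<noteq> v" if "u < n" "v < n" "adjacent n ?M u v" for u v
  proof -
    have "(u, v) \<in> parcs G"
      using that xs(7) by blast
    then have "(v, u) \<in> parcs G" "u \<noteq> v"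
      using G.arcs_symmetric G.no_loops' by blast+
    then show ?thesis
      using that xs(7) by blast
  qed
  show "accepts off ?M (length x) p"
    unfolding accepts_def Let_def xs(2,4) card_of_bool code_eq sets
    by (intro conjI xs(1,3) p l walk all) (use sym in blast)
qed

text \<open>
  No recursion is longer than \<open>N p * (length x + p + 1)\<close>. The factor 3 in \<open>N\<close> covers the
  multiplications by the constant 3 that compute addresses in the input.
\<close>

theorem fixed_parameter_tractable_timed_reconf_TS:
  "fixed_parameter_tractable (timed_reconf_TS (alliance_property off))"
proof -
  define D where "D = depth (mainE off)"
  \<comment> \<open>The 2 pays for the final \<open>Move\<close> of \<open>program\<close>.\<close>
  define C where "C = weight (mainE off) + 2"
  define N where "N p = 3 * base p ^ (p + 1)" for p
  define f where "f p = C * N p ^ D" for p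
  \<comment> \<open>Since \<open>C\<close> and \<open>D\<close> are constants, they enter as
    literals, and \<open>f\<close> becomes computable by the same compiler.\<close>
  define e where "e = letE 6 baseE (letE 7 (powE 6 (Plus (Var 0) (Lit 1))) (letE 8 (mulE (Lit 3) 7)
     (letE 9 (powE 8 (Lit D)) (mulE (Lit C) 9))))"
  have "below 50 e"
    by (simp add: e_def letE_def baseE_def powE_def mulE_def)
  moreover have "eval e ((\<lambda>_. 0)(0 := p)) (\<lambda>_. 0) = f p" for p
    by (simp add: e_def f_def N_def)
  ultimately have f: "computable f"
    using computable_expr[of e] by simp
  have "\<exists>t R M. exec (program (mainE off)) (input_state x p) t (R, M) \<and>
      R 0 = of_bool ((x, p) \<in> timed_reconf_TS (alliance_property off)) \<and>
      t \<le> f p * (length x + p + 1) ^ D" for x p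
  proof -
    define R0 :: "nat \<Rightarrow> nat" where "R0 = (\<lambda>_. 0)(0 := p, 1 := length x)"
    have input: "input_state x p = (R0, memory x)"
      by (auto simp: input_state_def R0_def memory_def)
    have eval: "eval (mainE off) R0 (memory x) = of_bool ((x, p) \<in> timed_reconf_TS (alliance_property off))"
      by (subst eval_mainE[where p = p and L = "length x"]) (simp_all add: R0_def accepts_iff)
    obtain R' where R': "exec (program (mainE off)) (R0, memory x) (cost (mainE off) R0 (memory x) + 2) (R', memory x)"
        "R' 0 = eval (mainE off) R0 (memory x)"
      using exec_program[OF below_mainE, of off R0 "memory x"] by (elim exE conjE) (rule that)
    define m where "m = N p * (length x + p + 1)"
    have "base p ^ (p + 1) \<ge> 1"
      by (rule one_le_power) (simp add: base_def)
    then have N: "3 \<le> N p" "base p ^ (p + 1) \<le> N p"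
      unfolding N_def by linarith+
    have m: "N p \<le> m" "length x + p + 1 \<le> m"
      using N(1) mult_right_mono[of 1 "N p" "length x + p + 1"] by (simp_all add: m_def)
    have "bounded m (mainE off) R0 (memory x)"
      by (rule bounded_mainE) (use N m in \<open>auto simp: R0_def\<close>)
    then have "cost (mainE off) R0 (memory x) \<le> weight (mainE off) * m ^ D"
      using cost_le N(1) m(1) unfolding D_def by simp
    moreover have "1 \<le> m ^ D"
      using N(1) m(1) by simp
    ultimately have "cost (mainE off) R0 (memory x) + 2 \<le> C * m ^ D"
      unfolding C_def distrib_right by linarith
    \<comment> \<open>As \<open>m\<close> is \<open>N p\<close> times the input size plus 1, its
      power splits into a factor depending on \<open>p\<close> alone and a polynomial one.\<close>
    also have "\<dots> = f p * (length x + p + 1) ^ D"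
      unfolding f_def m_def power_mult_distrib by (simp only: mult.assoc)
    finally show ?thesis
      unfolding input using R'(1) R'(2)[unfolded eval] by (intro exI conjI)
  qed
  then have "\<forall>x p. \<exists>t R M. exec (program (mainE off)) (input_state x p) t (R, M) \<and>
      R 0 = of_bool ((x, p) \<in> timed_reconf_TS (alliance_property off)) \<and>
      t \<le> f p * (length x + p + 1) ^ D"
    by (intro allI)
  with f show ?thesis
    unfolding fixed_parameter_tractable_def
    by - (rule exI[of _ "program (mainE off)"], rule exI[of _ f], rule exI[of _ D], rule conjI)
qed

theorem theorem5:
  shows "fixed_parameter_tractable (timed_reconf_TS defensive_alliance) \<and>
         fixed_parameter_tractable (timed_reconf_TS offensive_alliance)"
  using fixed_parameter_tractable_timed_reconf_TS[of False]
    fixed_parameter_tractable_timed_reconf_TS[of True]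
  by (simp only: if_True if_False)

end
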